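(* Let $N\geq 2$, $1<p<N$, and let $\Omega\subset\mathbb{R}^N$ be a bounded and smooth domain. Let $p^\star:=\frac{Np}{N-p}$ and, for $1\leq q\leq p^\star$, let $$\lambda_q:=\inf\left\{\frac{\|\nabla u\|_{p}^p}{\|u\|_{q}^p}: u\in W_0^{1,p}(\Omega)\setminus\{0\}\right\}.$$ Then the function $q\mapsto\lambda_q$ is absolutely continuous in the closed interval $[1,p^\star]$.
   Context: $\|\cdot\|_s:=\left(\int_\Omega|\cdot|^s\,dx\right)^{1/s}$ denotes the usual norm of $L^s(\Omega)$, and $W_0^{1,p}(\Omega)$ is the usual Sobolev space (closure of $C_c^\infty(\Omega)$ in $W^{1,p}(\Omega)$). *)

theory Defs
  imports "HOL-Analysis.Analysis"
begin

text \<open>Intended for open \<open>U\<close> only.\<close>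

primrec Ck_on :: "nat \<Rightarrow> 'a::euclidean_space set \<Rightarrow> ('a \<Rightarrow> real) \<Rightarrow> bool" where
  "Ck_on 0 U f \<longleftrightarrow> continuous_on U f"
| "Ck_on (Suc k) U f \<longleftrightarrow>
     (\<forall>x\<in>U. f differentiable (at x)) \<and>
     (\<forall>i\<in>Basis. Ck_on k U (\<lambda>x. frechet_derivative f (at x) i))"

definition smooth_on :: "'a::euclidean_space set \<Rightarrow> ('a \<Rightarrow> real) \<Rightarrow> bool" where
  "smooth_on U f \<longleftrightarrow> (\<forall>k. Ck_on k U f)"

text \<open>Elements of \<open>C\<^sub>c\<^sup>\<infinity>(\<Omega>)\<close> are represented by their extensions by zero to the whole space.\<close>

definition test_functions :: "'a::euclidean_space set \<Rightarrow> ('a \<Rightarrow> real) set" where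
  "test_functions \<Omega> =
     {\<phi>. smooth_on UNIV \<phi> \<and> (\<exists>K. compact K \<and> K \<subseteq> \<Omega> \<and> (\<forall>x. x \<notin> K \<longrightarrow> \<phi> x = 0))}"

text \<open>Locally, and up to a rotation of the axes, the domain is the region above the graph of a
  smooth function \<open>\<gamma>\<close> of the remaining \<open>N - 1\<close> variables.  The unit vector \<open>\<nu>\<close> is the direction of
  the last axis; \<open>\<gamma>\<close> is only evaluated on the hyperplane orthogonal to \<open>\<nu>\<close>, and smooth functions on
  that hyperplane are exactly the restrictions of smooth functions on the whole space.\<close>

definition smooth_boundary :: "'a::euclidean_space set \<Rightarrow> bool" where
  "smooth_boundary \<Omega> \<longleftrightarrow>
     (\<forall>x0\<in>frontier \<Omega>. \<exists>r>0. \<exists>\<nu> \<gamma>. norm \<nu> = 1 \<and> smooth_on UNIV \<gamma> \<and>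
        \<Omega> \<inter> ball x0 r = {x \<in> ball x0 r. \<gamma> (x - (x \<bullet> \<nu>) *\<^sub>R \<nu>) < x \<bullet> \<nu>})"

definition bounded_smooth_domain :: "'a::euclidean_space set \<Rightarrow> bool" where
  "bounded_smooth_domain \<Omega> \<longleftrightarrow>
     open \<Omega> \<and> connected \<Omega> \<and> \<Omega> \<noteq> {} \<and> bounded \<Omega> \<and> smooth_boundary \<Omega>"

text \<open>Members of these spaces are functions rather than almost-everywhere classes, and only their
  values on \<open>\<Omega>\<close> matter.  The vector-valued case is used for gradients.\<close>

definition Lp_space :: "real \<Rightarrow> 'a::euclidean_space set \<Rightarrow> ('a \<Rightarrow> 'b::euclidean_space) set" where
  "Lp_space s \<Omega> =
     {f. f \<in> borel_measurable (lebesgue_on \<Omega>) \<and>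
         integrable (lebesgue_on \<Omega>) (\<lambda>x. norm (f x) powr s)}"

definition Lp_norm :: "real \<Rightarrow> 'a::euclidean_space set \<Rightarrow> ('a \<Rightarrow> 'b::euclidean_space) \<Rightarrow> real" where
  "Lp_norm s \<Omega> f = (LINT x|lebesgue_on \<Omega>. norm (f x) powr s) powr (1 / s)"

definition locally_integrable_on ::
    "('a::euclidean_space \<Rightarrow> 'b::euclidean_space) \<Rightarrow> 'a set \<Rightarrow> bool"
    (infixr "locally'_integrable'_on" 46) where
  "f locally_integrable_on \<Omega> \<longleftrightarrow>
     (\<forall>K. compact K \<and> K \<subseteq> \<Omega> \<longrightarrow> f absolutely_integrable_on K)"

definition has_weak_gradient ::
    "'a::euclidean_space set \<Rightarrow> ('a \<Rightarrow> real) \<Rightarrow> ('a \<Rightarrow> 'a) \<Rightarrow> bool" where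
  "has_weak_gradient \<Omega> u g \<longleftrightarrow>
     u locally_integrable_on \<Omega> \<and> g locally_integrable_on \<Omega> \<and>
     (\<forall>\<phi>\<in>test_functions \<Omega>. \<forall>i\<in>Basis.
        (LINT x|lebesgue_on \<Omega>. u x * frechet_derivative \<phi> (at x) i) =
        - (LINT x|lebesgue_on \<Omega>. (g x \<bullet> i) * \<phi> x))"

text \<open>The choice is immaterial: on an open set, weak gradients are unique up to null sets.\<close>

definition weak_gradient :: "'a::euclidean_space set \<Rightarrow> ('a \<Rightarrow> real) \<Rightarrow> 'a \<Rightarrow> 'a" where
  "weak_gradient \<Omega> u = (SOME g. has_weak_gradient \<Omega> u g)"

definition W1p :: "real \<Rightarrow> 'a::euclidean_space set \<Rightarrow> ('a \<Rightarrow> real) set" where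
  "W1p p \<Omega> = {u \<in> Lp_space p \<Omega>. \<exists>g\<in>Lp_space p \<Omega>. has_weak_gradient \<Omega> u g}"

definition W1p_norm :: "real \<Rightarrow> 'a::euclidean_space set \<Rightarrow> ('a \<Rightarrow> real) \<Rightarrow> real" where
  "W1p_norm p \<Omega> u =
     (Lp_norm p \<Omega> u powr p + Lp_norm p \<Omega> (weak_gradient \<Omega> u) powr p) powr (1 / p)"

definition W1p_0 :: "real \<Rightarrow> 'a::euclidean_space set \<Rightarrow> ('a \<Rightarrow> real) set" where
  "W1p_0 p \<Omega> =
     {u \<in> W1p p \<Omega>. \<forall>\<epsilon>>0. \<exists>\<phi>\<in>test_functions \<Omega>. W1p_norm p \<Omega> (\<lambda>x. u x - \<phi> x) < \<epsilon>}"

definition critical_exponent :: "nat \<Rightarrow> real \<Rightarrow> real" where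
  "critical_exponent N p = real N * p / (real N - p)"

text \<open>Nonzero in \<open>W\<^sub>0\<^sup>1\<^sup>,\<^sup>p(\<Omega>)\<close> means not almost everywhere zero on \<open>\<Omega>\<close>.
  For \<open>q\<close> up to the critical exponent the norm in the denominator is finite by the Sobolev
  embedding, so the Bochner integral's default value for non-integrable functions plays no role.\<close>

definition sobolev_const :: "real \<Rightarrow> 'a::euclidean_space set \<Rightarrow> real \<Rightarrow> real" where
  "sobolev_const p \<Omega> q =
     Inf {Lp_norm p \<Omega> (weak_gradient \<Omega> u) powr p / Lp_norm q \<Omega> u powr p | u.
            u \<in> W1p_0 p \<Omega> \<and> \<not> (AE x in lebesgue_on \<Omega>. u x = 0)}"

definition absolutely_continuous_on_interval :: "real \<Rightarrow> real \<Rightarrow> (real \<Rightarrow> real) \<Rightarrow> bool" where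
  "absolutely_continuous_on_interval a b f \<longleftrightarrow>
     (\<forall>\<epsilon>>0. \<exists>\<delta>>0. \<forall>n (x :: nat \<Rightarrow> real) (y :: nat \<Rightarrow> real).
        (\<forall>k<n. a \<le> x k \<and> x k < y k \<and> y k \<le> b) \<and>
        disjoint_family_on (\<lambda>k. {x k<..<y k}) {..<n} \<and>
        (\<Sum>k<n. y k - x k) < \<delta> \<longrightarrow>
        (\<Sum>k<n. \<bar>f (y k) - f (x k)\<bar>) < \<epsilon>)"

end

theory Submission
  imports Defs
begin

text \<open>Put \<open>I u q = \<integral> \<bar>u\<bar>\<^sup>q\<close> and \<open>E u = \<parallel>\<nabla>u\<parallel>\<^sub>p\<^sup>p\<close>, so that \<open>\<lambda>\<^sub>q\<close> is the infimum over \<open>u\<close> of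
\<open>E u / (I u q) powr (p / q)\<close>, and let \<open>P\<close> be the critical exponent. Three properties of this family
of quotients give absolute continuity.

\<^item> For each \<open>u\<close> the function \<open>q \<mapsto> ln (I u q)\<close> is convex, by Hoelder's inequality. Hence
\<open>q * ln \<lambda>\<^sub>q\<close> is an infimum of concave functions of \<open>q\<close>. It is defined on the open interval from
\<open>0\<close> to \<open>P\<close>, which contains the endpoint \<open>1\<close> in its interior; a finite concave function is Lipschitz on
compact subintervals, so \<open>\<lambda>\<close> is Lipschitz on every interval from \<open>1\<close> to \<open>c < P\<close>.

\<^item> Normalising the measure of \<open>\<Omega>\<close> to \<open>1\<close> makes every \<open>L\<^sup>q\<close> norm increase with \<open>q\<close>. So
\<open>g q = \<bar>\<Omega>\<bar> powr (p / q) * \<lambda>\<^sub>q\<close> is decreasing up to and including \<open>P\<close>.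

\<^item> If \<open>g \<ge> m > 0\<close> below \<open>P\<close>, every \<open>u\<close> satisfies a bound on \<open>I u q\<close> that is uniform for \<open>q < P\<close>, and
Fatou's lemma carries it to \<open>q = P\<close>. Therefore \<open>g\<close> is continuous from the left at \<open>P\<close>.

A decreasing function that is Lipschitz away from the right end and continuous there is absolutely
continuous, since its total variation near that end is the small drop of its values; multiplying by the smooth
factor \<open>\<bar>\<Omega>\<bar> powr (- p / q)\<close> keeps this property. The argument takes place in
\<open>absolutely_continuous_Inf_quotient\<close>, whose hypothesis on the quotients is that \<open>\<lambda>\<^sub>q > 0\<close> for \<open>0 < q < P\<close>.

That positivity is the Sobolev inequality below the critical exponent. For a test function \<open>\<phi>\<close> the
fundamental theorem of calculus along the rays \<open>x + t z\<close> bounds \<open>\<bar>\<phi> x\<bar>\<close> by an average of \<open>\<bar>\<nabla>\<phi>\<bar>\<close> over \<open>t\<close>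
in a bounded interval and \<open>z\<close> in a box that stays away from \<open>0\<close>; weighting with powers of \<open>t\<close> and
using Young's inequality gives \<open>\<parallel>\<phi>\<parallel>\<^sub>q \<le> C \<parallel>\<nabla>\<phi>\<parallel>\<^sub>p\<close> (\<open>subcritical_sobolev\<close>). Density and Fatou's lemma extend it
to \<open>W\<^sub>0\<^sup>1\<^sup>,\<^sup>p(\<Omega>)\<close> (\<open>W1p_0_subcritical_embedding\<close>). Because the weak gradient in the Sobolev norm
is an arbitrary choice, this last step rests on its uniqueness, which follows from the
fundamental lemma of the calculus of variations (\<open>AE_eq_0_if_test_functions\<close>) and an explicit family of
smooth bump functions.\<close>

section \<open>Absolute continuity of functions of one variable\<close>

text \<open>Induction on the interval with the largest right end: the others lie to its left, so the
induction hypothesis applies with that interval's left end in place of \<open>b\<close>.\<close>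

lemma sum_increments_le:
  fixes h :: "real \<Rightarrow> real" and x y :: "_ \<Rightarrow> real"
  assumes "finite I" and "mono_on {a..b} h" and "a \<le> b"
    and "\<And>k. k \<in> I \<Longrightarrow> a \<le> x k \<and> x k < y k \<and> y k \<le> b"
    and "disjoint_family_on (\<lambda>k. {x k<..<y k}) I"
  shows "(\<Sum>k\<in>I. h (y k) - h (x k)) \<le> h b - h a"
  using assms
proof (induction I arbitrary: b rule: finite_ranking_induct[where f = y])
  case empty
  then show ?case by (auto simp: mono_on_def)
next
  case (insert k S)
  show ?case
  proof (cases "k \<in> S")
    case True
    then have "insert k S = S" by auto
    then show ?thesis using insert by metis
  next
    case False
    have k: "a \<le> x k" "x k < y k" "y k \<le> b" using insert.prems by auto
    have left: "y j \<le> x k" if "j \<in> S" for j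
    proof (rule ccontr)
      assume "\<not> y j \<le> x k"
      moreover have "x j < y j" "y j \<le> y k" using insert.prems(3) insert.hyps that by auto
      ultimately have "(max (x j) (x k) + y j) / 2 \<in> {x j<..<y j} \<inter> {x k<..<y k}"
        by (auto simp: max_def field_simps)
      moreover have "j \<noteq> k" using False that by auto
      ultimately show False using insert.prems(4) that unfolding disjoint_family_on_def by blast
    qed
    have "(\<Sum>j\<in>S. h (y j) - h (x j)) \<le> h (x k) - h a"
    proof (rule insert.IH)
      show "mono_on {a..x k} h"
        by (rule mono_on_subset[OF insert.prems(1)]) (use k in auto)
      show "disjoint_family_on (\<lambda>k. {x k<..<y k}) S"
        using insert.prems(4) by (rule disjoint_family_on_mono[rotated]) auto
    qed (use insert.prems(3) left k in auto)
    moreover have "h (y k) \<le> h b" using insert.prems(1,2) k by (auto simp: mono_on_def)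
    ultimately show ?thesis using False insert.hyps by simp
  qed
qed

lemma absolutely_continuous_on_interval_cong:
  assumes f: "absolutely_continuous_on_interval a b f" and eq: "\<And>t. t \<in> {a..b} \<Longrightarrow> f t = g t"
  shows "absolutely_continuous_on_interval a b g"
  unfolding absolutely_continuous_on_interval_def
proof (intro allI impI)
  fix \<epsilon> :: real assume "\<epsilon> > 0"
  then obtain \<delta> where "\<delta> > 0" and \<delta>: "\<And>n (x :: nat \<Rightarrow> real) (y :: nat \<Rightarrow> real).
        (\<forall>k<n. a \<le> x k \<and> x k < y k \<and> y k \<le> b) \<and>
        disjoint_family_on (\<lambda>k. {x k<..<y k}) {..<n} \<and>
        (\<Sum>k<n. y k - x k) < \<delta> \<Longrightarrow> (\<Sum>k<n. \<bar>f (y k) - f (x k)\<bar>) < \<epsilon>"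
    using f[unfolded absolutely_continuous_on_interval_def, rule_format, of \<epsilon>] by auto
  show "\<exists>\<delta>>0. \<forall>n (x :: nat \<Rightarrow> real) (y :: nat \<Rightarrow> real).
        (\<forall>k<n. a \<le> x k \<and> x k < y k \<and> y k \<le> b) \<and>
        disjoint_family_on (\<lambda>k. {x k<..<y k}) {..<n} \<and>
        (\<Sum>k<n. y k - x k) < \<delta> \<longrightarrow> (\<Sum>k<n. \<bar>g (y k) - g (x k)\<bar>) < \<epsilon>"
  proof (intro exI[of _ \<delta>] conjI allI impI, fact)
    fix n :: nat and x y :: "nat \<Rightarrow> real"
    assume A: "(\<forall>k<n. a \<le> x k \<and> x k < y k \<and> y k \<le> b) \<and>
       disjoint_family_on (\<lambda>k. {x k<..<y k}) {..<n} \<and> (\<Sum>k<n. y k - x k) < \<delta>"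
    have "g (y k) = f (y k)" "g (x k) = f (x k)" if "k < n" for k
      using A that eq[of "y k"] eq[of "x k"] by force+
    then have "(\<Sum>k<n. \<bar>g (y k) - g (x k)\<bar>) = (\<Sum>k<n. \<bar>f (y k) - f (x k)\<bar>)"
      by (intro sum.cong) auto
    then show "(\<Sum>k<n. \<bar>g (y k) - g (x k)\<bar>) < \<epsilon>" using \<delta>[OF A] by simp
  qed
qed

text \<open>Fix \<open>c\<close> so close to \<open>b\<close> that \<open>g\<close> drops by less than \<open>\<epsilon> / 2\<close> on \<open>[c, b]\<close>. The increments
of \<open>g\<close> split into a part on \<open>[a, c]\<close>, controlled by the Lipschitz constant and the total length of
the intervals, and a part on \<open>[c, b]\<close>, whose sum is at most the total drop, however the intervals lie.\<close>

lemma absolutely_continuous_if_antimono: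
  assumes "a < b" and anti: "antimono_on {a..b} g"
    and lip: "\<And>c. a < c \<Longrightarrow> c < b \<Longrightarrow> \<exists>L. L-lipschitz_on {a..c} g"
    and lim: "\<And>\<epsilon>. \<epsilon> > 0 \<Longrightarrow> \<exists>c. a \<le> c \<and> c < b \<and> g c < g b + \<epsilon>"
  shows "absolutely_continuous_on_interval a b g"
  unfolding absolutely_continuous_on_interval_def
proof (intro allI impI)
  fix \<epsilon> :: real assume "\<epsilon> > 0"
  obtain c0 where c0: "a \<le> c0" "c0 < b" "g c0 < g b + \<epsilon> / 2" using lim[of "\<epsilon>/2"] \<open>\<epsilon> > 0\<close> by auto
  define c where "c = (c0 + b) / 2"
  have c: "a < c" "c < b" "c0 \<le> c" using c0 unfolding c_def by auto
  have gc: "g c < g b + \<epsilon> / 2" using c0 c anti by (force simp: monotone_on_def)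
  obtain L where L: "L-lipschitz_on {a..c} g" using lip c by blast
  have L0: "L \<ge> 0" using L by (rule lipschitz_on_nonneg)
  define \<delta> where "\<delta> = \<epsilon> / (2 * (L + 1))"
  have "\<delta> > 0" using \<open>\<epsilon> > 0\<close> L0 unfolding \<delta>_def by auto
  have L\<delta>: "L * \<delta> \<le> \<epsilon> / 2" using \<open>\<epsilon> > 0\<close> L0 unfolding \<delta>_def by (simp add: field_simps)
  show "\<exists>\<delta>>0. \<forall>n (x :: nat \<Rightarrow> real) (y :: nat \<Rightarrow> real). (\<forall>k<n. a \<le> x k \<and> x k < y k \<and> y k \<le> b) \<and>
       disjoint_family_on (\<lambda>k. {x k<..<y k}) {..<n} \<and> (\<Sum>k<n. y k - x k) < \<delta> \<longrightarrow>
       (\<Sum>k<n. \<bar>g (y k) - g (x k)\<bar>) < \<epsilon>"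
  proof (intro exI[of _ \<delta>] conjI allI impI, fact)
    fix n :: nat and x y :: "nat \<Rightarrow> real"
    assume A: "(\<forall>k<n. a \<le> x k \<and> x k < y k \<and> y k \<le> b) \<and>
       disjoint_family_on (\<lambda>k. {x k<..<y k}) {..<n} \<and> (\<Sum>k<n. y k - x k) < \<delta>"
    \<comment> \<open>freezing \<open>g\<close> to the left of \<open>c\<close> leaves the given intervals untouched\<close>
    define h where "h t = - g (max t c)" for t
    have hmono: "mono_on {a..b} h"
      unfolding h_def using c by (auto intro!: mono_onI monotone_onD[OF anti])
    have "\<bar>g (y k) - g (x k)\<bar> \<le> L * (y k - x k) + (h (y k) - h (x k))" if "k < n" for k
    proof -
      have k: "a \<le> x k" "x k < y k" "y k \<le> b" using A that by auto
      have lip': "\<bar>g u - g v\<bar> \<le> L * (v - u)" if "a \<le> u" "u \<le> v" "v \<le> c" for u v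
        using lipschitz_onD[OF L, of u v] that by (auto simp: dist_real_def)
      have "g (y k) \<le> g (x k)" using anti k by (force simp: monotone_on_def)
      then have "\<bar>g (y k) - g (x k)\<bar> = (g (min (x k) c) - g (min (y k) c)) + (h (y k) - h (x k))"
        unfolding h_def using k by (auto simp: min_def max_def)
      moreover have "g (min (x k) c) - g (min (y k) c) \<le> L * (min (y k) c - min (x k) c)"
        using lip'[of "min (x k) c" "min (y k) c"] k c by (auto simp: min_def split: if_splits)
      moreover have "L * (min (y k) c - min (x k) c) \<le> L * (y k - x k)"
        by (rule mult_left_mono) (use k L0 in auto)
      ultimately show ?thesis by linarith
    qed
    then have "(\<Sum>k<n. \<bar>g (y k) - g (x k)\<bar>) \<le> (\<Sum>k<n. L * (y k - x k) + (h (y k) - h (x k)))"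
      by (intro sum_mono) auto
    also have "\<dots> = L * (\<Sum>k<n. y k - x k) + (\<Sum>k<n. h (y k) - h (x k))"
      by (simp add: sum.distrib sum_distrib_left)
    also have "(\<Sum>k<n. h (y k) - h (x k)) \<le> h b - h a"
      using A hmono \<open>a < b\<close> by (intro sum_increments_le) auto
    also have "h b - h a = g c - g b" using c unfolding h_def by (auto simp: max_def)
    also have "L * (\<Sum>k<n. y k - x k) \<le> L * \<delta>" using A L0 by (intro mult_left_mono) auto
    finally show "(\<Sum>k<n. \<bar>g (y k) - g (x k)\<bar>) < \<epsilon>" using gc L\<delta> by linarith
  qed
qed

lemma absolutely_continuous_lipschitz_mult:
  assumes g: "absolutely_continuous_on_interval a b g"
    and m: "L-lipschitz_on {a..b} m"
    and bdg: "\<And>t. t \<in> {a..b} \<Longrightarrow> \<bar>g t\<bar> \<le> B" and bdm: "\<And>t. t \<in> {a..b} \<Longrightarrow> \<bar>m t\<bar> \<le> B"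
  shows "absolutely_continuous_on_interval a b (\<lambda>t. m t * g t)"
  unfolding absolutely_continuous_on_interval_def
proof (intro allI impI)
  fix \<epsilon> :: real assume "\<epsilon> > 0"
  define C where "C = max B 1"
  have C: "C \<ge> 1" "B \<le> C" unfolding C_def by auto
  have L0: "L \<ge> 0" using m by (rule lipschitz_on_nonneg)
  \<comment> \<open>half of \<open>\<epsilon>\<close> for each of the two terms of the product rule for increments\<close>
  obtain \<delta>1 where "\<delta>1 > 0" and \<delta>1: "\<And>n (x :: nat \<Rightarrow> real) (y :: nat \<Rightarrow> real).
        (\<forall>k<n. a \<le> x k \<and> x k < y k \<and> y k \<le> b) \<and>
        disjoint_family_on (\<lambda>k. {x k<..<y k}) {..<n} \<and>
        (\<Sum>k<n. y k - x k) < \<delta>1 \<Longrightarrow>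
        (\<Sum>k<n. \<bar>g (y k) - g (x k)\<bar>) < \<epsilon> / (2 * C)"
    using g[unfolded absolutely_continuous_on_interval_def, rule_format, of "\<epsilon> / (2 * C)"] \<open>\<epsilon> > 0\<close> C
    by auto
  define \<delta> where "\<delta> = min \<delta>1 (\<epsilon> / (2 * C * (L + 1)))"
  have "\<delta> > 0" using \<open>\<epsilon> > 0\<close> \<open>\<delta>1 > 0\<close> C L0 unfolding \<delta>_def by auto
  have "C * L * \<delta> \<le> C * L * (\<epsilon> / (2 * C * (L + 1)))"
    unfolding \<delta>_def by (intro mult_left_mono) (use C L0 in auto)
  also have "\<dots> = \<epsilon> / 2 * (L / (L + 1))" using C L0 by (simp add: divide_simps)
  also have "\<dots> \<le> \<epsilon> / 2 * 1" using L0 \<open>\<epsilon> > 0\<close> by (intro mult_left_mono) auto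
  finally have L\<delta>: "C * L * \<delta> \<le> \<epsilon> / 2" by simp
  show "\<exists>\<delta>>0. \<forall>n (x :: nat \<Rightarrow> real) (y :: nat \<Rightarrow> real). (\<forall>k<n. a \<le> x k \<and> x k < y k \<and> y k \<le> b) \<and>
       disjoint_family_on (\<lambda>k. {x k<..<y k}) {..<n} \<and> (\<Sum>k<n. y k - x k) < \<delta> \<longrightarrow>
       (\<Sum>k<n. \<bar>m (y k) * g (y k) - m (x k) * g (x k)\<bar>) < \<epsilon>"
  proof (intro exI[of _ \<delta>] conjI allI impI, fact)
    fix n :: nat and x y :: "nat \<Rightarrow> real"
    assume A: "(\<forall>k<n. a \<le> x k \<and> x k < y k \<and> y k \<le> b) \<and>
       disjoint_family_on (\<lambda>k. {x k<..<y k}) {..<n} \<and> (\<Sum>k<n. y k - x k) < \<delta>"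
    have "\<bar>m (y k) * g (y k) - m (x k) * g (x k)\<bar> \<le> C * \<bar>g (y k) - g (x k)\<bar> + C * L * (y k - x k)"
      if "k < n" for k
    proof -
      have k: "x k \<in> {a..b}" "y k \<in> {a..b}" "x k < y k" using A that by force+
      have "\<bar>m (y k) * g (y k) - m (x k) * g (x k)\<bar>
          = \<bar>m (y k) * (g (y k) - g (x k)) + g (x k) * (m (y k) - m (x k))\<bar>"
        by (simp add: algebra_simps)
      also have "\<dots> \<le> \<bar>m (y k)\<bar> * \<bar>g (y k) - g (x k)\<bar> + \<bar>g (x k)\<bar> * \<bar>m (y k) - m (x k)\<bar>"
        by (metis abs_mult abs_triangle_ineq)
      also have "\<dots> \<le> C * \<bar>g (y k) - g (x k)\<bar> + C * (L * (y k - x k))"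
      proof (intro add_mono mult_mono)
        show "\<bar>m (y k) - m (x k)\<bar> \<le> L * (y k - x k)"
          using lipschitz_onD[OF m k(2,1)] k by (auto simp: dist_real_def)
      qed (use k bdg bdm C L0 order_trans in \<open>auto, (smt (verit) atLeastAtMost_iff)+\<close>)
      finally show ?thesis by (simp add: mult.assoc)
    qed
    then have "(\<Sum>k<n. \<bar>m (y k) * g (y k) - m (x k) * g (x k)\<bar>)
        \<le> (\<Sum>k<n. C * \<bar>g (y k) - g (x k)\<bar> + C * L * (y k - x k))"
      by (intro sum_mono) auto
    also have "\<dots> = C * (\<Sum>k<n. \<bar>g (y k) - g (x k)\<bar>) + C * L * (\<Sum>k<n. y k - x k)"
      by (simp add: sum.distrib sum_distrib_left)
    also have "C * L * (\<Sum>k<n. y k - x k) \<le> C * L * \<delta>"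
      using A C L0 by (intro mult_left_mono) auto
    also have "C * (\<Sum>k<n. \<bar>g (y k) - g (x k)\<bar>) < C * (\<epsilon> / (2 * C))"
      by (intro mult_strict_left_mono \<delta>1) (use A C in \<open>auto simp: \<delta>_def\<close>)
    also have "C * (\<epsilon> / (2 * C)) = \<epsilon> / 2" using C by simp
    finally show "(\<Sum>k<n. \<bar>m (y k) * g (y k) - m (x k) * g (x k)\<bar>) < \<epsilon>" using L\<delta> by linarith
  qed
qed

text \<open>Slopes of a convex function increase, so every slope inside \<open>[c, d]\<close> lies between one slope
taken to the left of \<open>c\<close> and one taken to the right of \<open>d\<close>. Both exist because the interval is open.\<close>

lemma concave_on_imp_lipschitz_on:
  fixes f :: "real \<Rightarrow> real"
  assumes f: "concave_on {a<..<b} f" and "a < c" and "d < b"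
  shows "\<exists>L. L-lipschitz_on {c..d} f"
proof (cases "c \<le> d")
  case True
  define h where "h x = - f x" for x
  have h: "convex_on {a<..<b} h" using f unfolding concave_on_def h_def .
  define a' where "a' = (a + c) / 2" define b' where "b' = (d + b) / 2"
  have ab: "a < a'" "a' < c" "d < b'" "b' < b" using assms unfolding a'_def b'_def by auto
  define l where "l = (h a' - h c) / (a' - c)"
  define r where "r = (h d - h b') / (d - b')"
  have slope: "l \<le> (h x - h y) / (x - y)" "(h x - h y) / (x - y) \<le> r"
    if "c \<le> x" "x < y" "y \<le> d" for x y
  proof -
    have "l \<le> (h a' - h y) / (a' - y)"
      unfolding l_def
      by (rule convex_on_slope_le(1)[OF h]) (use that ab in auto)
    also have "\<dots> \<le> (h x - h y) / (x - y)"
      by (rule convex_on_slope_le(2)[OF h]) (use that ab in auto)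
    finally show "l \<le> (h x - h y) / (x - y)" .
    have "(h x - h y) / (x - y) \<le> (h x - h b') / (x - b')"
      by (rule convex_on_slope_le(1)[OF h]) (use that ab in auto)
    also have "\<dots> \<le> r"
      unfolding r_def
      by (rule convex_on_slope_le(2)[OF h]) (use that ab in auto)
    finally show "(h x - h y) / (x - y) \<le> r" .
  qed
  have "(\<bar>l\<bar> + \<bar>r\<bar>)-lipschitz_on {c..d} f"
  proof (rule lipschitz_on_leI)
    fix x y assume "x \<in> {c..d}" "y \<in> {c..d}" "x \<le> y"
    show "dist (f x) (f y) \<le> (\<bar>l\<bar> + \<bar>r\<bar>) * dist x y"
    proof (cases "x = y")
      case False
      with \<open>x \<le> y\<close> have "x < y" by simp
      have "\<bar>(h x - h y) / (x - y)\<bar> \<le> \<bar>l\<bar> + \<bar>r\<bar>"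
        using slope[of x y] \<open>x < y\<close> \<open>x \<in> _\<close> \<open>y \<in> _\<close>
        unfolding atLeastAtMost_iff by linarith
      then have "\<bar>h x - h y\<bar> \<le> (\<bar>l\<bar> + \<bar>r\<bar>) * \<bar>x - y\<bar>"
        using \<open>x < y\<close> unfolding abs_divide by (simp add: divide_le_eq)
      then show ?thesis unfolding dist_real_def h_def by (simp add: abs_minus_commute)
    qed auto
  qed auto
  then show ?thesis by blast
qed (auto intro: exI[of _ 0])

lemma lipschitz_on_of_continuous_derivative:
  fixes f :: "real \<Rightarrow> real"
  assumes "\<And>t. t \<in> {a..b} \<Longrightarrow> (f has_real_derivative f' t) (at t)" "continuous_on {a..b} f'"
  shows "\<exists>L. L-lipschitz_on {a..b} f"
proof -
  have "bounded (f' ` {a..b})"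
    by (intro compact_imp_bounded compact_continuous_image assms) auto
  then obtain B where B: "B > 0" "\<And>t. t \<in> {a..b} \<Longrightarrow> \<bar>f' t\<bar> \<le> B"
    unfolding bounded_pos by auto
  have "B-lipschitz_on {a..b} f"
  proof (rule lipschitz_onI)
    fix x y assume "x \<in> {a..b}" "y \<in> {a..b}"
    have "norm (f x - f y) \<le> B * norm (x - y)"
      by (rule field_differentiable_bound[where S = "{a..b}" and f' = f'])
        (use assms(1) B \<open>x \<in> _\<close> \<open>y \<in> _\<close> in \<open>auto intro: DERIV_subset\<close>)
    then show "dist (f x) (f y) \<le> B * dist x y" by (simp add: dist_norm)
  qed (use B in auto)
  then show ?thesis by blast
qed

lemma lipschitz_on_mult_Icc:
  fixes f g :: "real \<Rightarrow> real"
  assumes f: "L-lipschitz_on {a..b} f" and g: "K-lipschitz_on {a..b} g"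
  shows "\<exists>C. C-lipschitz_on {a..b} (\<lambda>t. f t * g t)"
proof -
  have "bounded (f ` {a..b})" "bounded (g ` {a..b})"
    using lipschitz_on_continuous_on[OF f] lipschitz_on_continuous_on[OF g]
    by (auto intro!: compact_imp_bounded compact_continuous_image)
  then obtain A B where A: "A > 0" "\<And>t. t \<in> {a..b} \<Longrightarrow> \<bar>f t\<bar> \<le> A"
    and B: "B > 0" "\<And>t. t \<in> {a..b} \<Longrightarrow> \<bar>g t\<bar> \<le> B"
    unfolding bounded_pos by auto
  note nn = lipschitz_on_nonneg[OF f] lipschitz_on_nonneg[OF g]
  have "(A * K + B * L)-lipschitz_on {a..b} (\<lambda>t. f t * g t)"
  proof (rule lipschitz_onI)
    fix x y assume xy: "x \<in> {a..b}" "y \<in> {a..b}"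
    have "\<bar>f x * g x - f y * g y\<bar> = \<bar>f x * (g x - g y) + g y * (f x - f y)\<bar>"
      by (simp add: algebra_simps)
    also have "\<dots> \<le> \<bar>f x\<bar> * \<bar>g x - g y\<bar> + \<bar>g y\<bar> * \<bar>f x - f y\<bar>"
      by (metis abs_mult abs_triangle_ineq)
    also have "\<dots> \<le> A * (K * dist x y) + B * (L * dist x y)"
      using lipschitz_onD[OF f xy] lipschitz_onD[OF g xy] A B xy
      by (intro add_mono mult_mono) (auto simp: dist_real_def)
    finally show "dist (f x * g x) (f y * g y) \<le> (A * K + B * L) * dist x y"
      by (simp add: dist_real_def algebra_simps)
  qed (use A B nn in auto)
  then show ?thesis by blast
qed

lemma lipschitz_on_exp_compose:
  fixes f :: "real \<Rightarrow> real"
  assumes f: "L-lipschitz_on {a..b} f"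
  shows "\<exists>C. C-lipschitz_on {a..b} (\<lambda>t. exp (f t))"
proof -
  have "bounded (f ` {a..b})"
    using lipschitz_on_continuous_on[OF f] by (auto intro!: compact_imp_bounded compact_continuous_image)
  then obtain B where B: "B > 0" "f ` {a..b} \<subseteq> {-B..B}"
    unfolding bounded_pos by (auto simp: abs_le_iff image_subset_iff minus_le_iff)
  obtain K where K: "K-lipschitz_on {-B..B} exp"
    using lipschitz_on_of_continuous_derivative[of "-B" B exp exp]
      continuous_on_exp[OF continuous_on_id] by auto
  have "(K * L)-lipschitz_on {a..b} (\<lambda>t. exp (f t))"
    by (rule lipschitz_on_compose2[OF f lipschitz_on_subset[OF K B(2)]])
  then show ?thesis by blast
qed

text \<open>The analytic core, separated from integration theory: concavity gives Lipschitz bounds away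
from \<open>P\<close>, and monotonicity with the limit condition takes care of \<open>P\<close> itself. The point \<open>1\<close> causes no
trouble because concavity holds on an interval that extends to the left of it.\<close>

theorem absolutely_continuous_of_log_concave:
  fixes V p P :: real
  assumes "1 < P" and V: "V > 0"
    and pos: "\<And>q. 0 < q \<Longrightarrow> q < P \<Longrightarrow> \<mu> q > 0" and nn: "\<mu> P \<ge> 0"
    and conc: "concave_on {0<..<P} (\<lambda>q. q * ln (\<mu> q))"
    and anti: "antimono_on {0<..P} (\<lambda>q. V powr (p / q) * \<mu> q)"
    and lim: "\<And>\<epsilon>. \<epsilon> > 0 \<Longrightarrow> \<exists>q. 1 \<le> q \<and> q < P \<and> V powr (p / q) * \<mu> q < V powr (p / P) * \<mu> P + \<epsilon>"
  shows "absolutely_continuous_on_interval 1 P \<mu>"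
proof -
  define g where "g q = V powr (p / q) * \<mu> q" for q
  have powr_lip: "\<exists>L. L-lipschitz_on {1..c} (\<lambda>q. V powr (s / q))" for c s
  proof (rule lipschitz_on_of_continuous_derivative)
    show "((\<lambda>q. V powr (s / q)) has_real_derivative (ln V * (- s / t\<^sup>2) * V powr (s / t))) (at t)"
      if "t \<in> {1..c}" for t
      using that V unfolding powr_def
      by (auto intro!: derivative_eq_intros simp: power2_eq_square field_simps)
    show "continuous_on {1..c} (\<lambda>t. ln V * (- s / t\<^sup>2) * V powr (s / t))"
      using V by (intro continuous_intros) auto
  qed
  have lam_lip: "\<exists>L. L-lipschitz_on {1..c} \<mu>" if "c < P" for c
  proof -
    obtain L where L: "L-lipschitz_on {1..c} (\<lambda>q. q * ln (\<mu> q))"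
      using concave_on_imp_lipschitz_on[OF conc, of 1 c] \<open>c < P\<close> by auto
    have "\<exists>K. K-lipschitz_on {1..c} (\<lambda>q::real. 1 / q)"
      by (rule lipschitz_on_of_continuous_derivative[of _ _ _ "\<lambda>t. - 1 / t\<^sup>2"])
        (auto intro!: derivative_eq_intros continuous_intros simp: power2_eq_square)
    then obtain K where K: "K-lipschitz_on {1..c} (\<lambda>q::real. 1 / q)" ..
    obtain K2 where "K2-lipschitz_on {1..c} (\<lambda>q. 1 / q * (q * ln (\<mu> q)))"
      using lipschitz_on_mult_Icc[OF K L] by blast
    then obtain C where "C-lipschitz_on {1..c} (\<lambda>q. exp (1 / q * (q * ln (\<mu> q))))"
      using lipschitz_on_exp_compose by blast
    moreover have "exp (1 / q * (q * ln (\<mu> q))) = \<mu> q" if "q \<in> {1..c}" for q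
      using that \<open>c < P\<close> pos[of q] by auto
    ultimately show ?thesis by (metis (no_types, lifting) lipschitz_on_cong)
  qed
  have anti1: "antimono_on {1..P} g"
    using anti unfolding g_def by (rule monotone_on_subset) auto
  have "absolutely_continuous_on_interval 1 P g"
  proof (rule absolutely_continuous_if_antimono[OF \<open>1 < P\<close> anti1])
    show "\<exists>L. L-lipschitz_on {1..c} g" if "1 < c" "c < P" for c
      unfolding g_def using lipschitz_on_mult_Icc powr_lip lam_lip[OF that(2)] by blast
  qed (use lim g_def in auto)
  moreover obtain L where L: "L-lipschitz_on {1..P} (\<lambda>q. V powr (- p / q))"
    using powr_lip[of P "-p"] by auto
  moreover have "bounded ((\<lambda>q. V powr (- p / q)) ` {1..P})"
    using lipschitz_on_continuous_on[OF L] by (auto intro!: compact_imp_bounded compact_continuous_image)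
  then obtain B where B: "\<And>t. t \<in> {1..P} \<Longrightarrow> \<bar>V powr (- p / t)\<bar> \<le> B"
    unfolding bounded_iff image_iff real_norm_def by blast
  moreover have "\<bar>g t\<bar> \<le> g 1" if "t \<in> {1..P}" for t
  proof -
    have "\<mu> t \<ge> 0" using pos[of t] nn that by (cases "t = P") auto
    then have "g t \<ge> 0" unfolding g_def by auto
    moreover have "g t \<le> g 1" using anti1 that \<open>1 < P\<close> by (force simp: monotone_on_def)
    ultimately show ?thesis by simp
  qed
  ultimately have "absolutely_continuous_on_interval 1 P (\<lambda>q. V powr (- p / q) * g q)"
    by (intro absolutely_continuous_lipschitz_mult[where B = "max B (g 1)"]) (auto simp: le_max_iff_disj)
  moreover have "V powr (- p / q) * g q = \<mu> q" for q
    using V unfolding g_def by (simp add: mult.assoc[symmetric] powr_add[symmetric])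
  ultimately show ?thesis by simp
qed

section \<open>Infima of quotients over a finite measure space\<close>

text \<open>Fatou's lemma for Bochner integrals; integrability of the limit is part of the conclusion, which
matters because the Bochner integral of a non-integrable function is \<open>0\<close>.\<close>

lemma integrable_Fatou:
  fixes f :: "nat \<Rightarrow> 'a \<Rightarrow> real"
  assumes int: "\<And>n. integrable M (f n)" and nn: "\<And>n x. f n x \<ge> 0"
    and [measurable]: "g \<in> borel_measurable M"
    and lim: "AE x in M. (\<lambda>n. f n x) \<longlonglongrightarrow> g x"
    and bd: "\<And>n. (\<integral>x. f n x \<partial>M) \<le> c n" and c: "c \<longlonglongrightarrow> C"
  shows "integrable M g \<and> (\<integral>x. g x \<partial>M) \<le> C"
proof -
  have [measurable]: "\<And>n. f n \<in> borel_measurable M" using int by auto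
  have g0: "AE x in M. g x \<ge> 0"
    using lim by eventually_elim (auto intro: LIMSEQ_le_const nn)
  have c0: "c n \<ge> 0" for n using bd[of n] Bochner_Integration.integral_nonneg[of M "f n"] nn by (meson order_trans)
  then have C0: "C \<ge> 0" using c by (auto intro: LIMSEQ_le_const)
  have "(\<integral>\<^sup>+x. ennreal (g x) \<partial>M) = (\<integral>\<^sup>+x. liminf (\<lambda>n. ennreal (f n x)) \<partial>M)"
    using lim by (intro nn_integral_cong_AE, eventually_elim)
      (auto intro!: lim_imp_Liminf[symmetric] tendsto_ennrealI)
  also have "\<dots> \<le> liminf (\<lambda>n. \<integral>\<^sup>+x. ennreal (f n x) \<partial>M)"
    by (intro nn_integral_liminf) auto
  also have "\<dots> \<le> liminf (\<lambda>n. ennreal (c n))"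
    using bd int nn by (intro Liminf_mono always_eventually) (auto simp: nn_integral_eq_integral intro!: ennreal_leI)
  also have "\<dots> = ennreal C"
    using c by (intro lim_imp_Liminf tendsto_ennrealI) auto
  finally have *: "(\<integral>\<^sup>+x. ennreal (g x) \<partial>M) \<le> ennreal C" .
  have "integrable M g"
    using * g0 by (intro integrableI_nonneg) (auto simp: le_less_trans)
  then show ?thesis
    using * g0 C0 by (simp add: nn_integral_eq_integral)
qed

lemma weighted_AM_GM:
  fixes x y :: real
  assumes "\<alpha> > 0" "\<beta> > 0" "\<alpha> + \<beta> = 1" "x \<ge> 0" "y \<ge> 0"
  shows "x powr \<alpha> * y powr \<beta> \<le> \<alpha> * x + \<beta> * y"
  using Youngs_inequality_0[of \<alpha> \<beta> x y] assms by (cases "x = 0 \<or> y = 0") auto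

lemma weighted_AM_GM3:
  fixes x y z :: real
  assumes "\<alpha> > 0" "\<beta> > 0" "\<gamma> > 0" "\<alpha> + \<beta> + \<gamma> = 1" "x > 0" "y > 0" "z > 0"
  shows "x powr \<alpha> * y powr \<beta> * z powr \<gamma> \<le> \<alpha> * x + \<beta> * y + \<gamma> * z"
proof -
  define \<delta> where "\<delta> = \<beta> + \<gamma>"
  have \<delta>: "\<delta> > 0" "\<alpha> + \<delta> = 1" "\<beta> / \<delta> + \<gamma> / \<delta> = 1"
    using assms unfolding \<delta>_def by (auto simp: add_divide_distrib[symmetric])
  have "y powr \<beta> * z powr \<gamma> = (y powr (\<beta> / \<delta>) * z powr (\<gamma> / \<delta>)) powr \<delta>"
    using \<delta>(1) by (simp add: powr_mult powr_powr)
  then have "x powr \<alpha> * y powr \<beta> * z powr \<gamma> = x powr \<alpha> * (y powr (\<beta> / \<delta>) * z powr (\<gamma> / \<delta>)) powr \<delta>"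
    by (simp add: mult.assoc)
  also have "\<dots> \<le> \<alpha> * x + \<delta> * (y powr (\<beta> / \<delta>) * z powr (\<gamma> / \<delta>))"
    by (rule weighted_AM_GM) (use assms \<delta> in auto)
  also have "\<delta> * (y powr (\<beta> / \<delta>) * z powr (\<gamma> / \<delta>)) \<le> \<delta> * (\<beta> / \<delta> * y + \<gamma> / \<delta> * z)"
    using \<delta> assms by (intro mult_left_mono weighted_AM_GM) auto
  also have "\<delta> * (\<beta> / \<delta> * y + \<gamma> / \<delta> * z) = \<beta> * y + \<gamma> * z"
    using \<delta>(1) by (simp add: field_simps)
  finally show ?thesis by simp
qed

text \<open>The weighted arithmetic-geometric mean inequality, applied pointwise to \<open>f\<close> and \<open>g\<close> divided by
their integrals.\<close>

lemma Holder_integral: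
  fixes f g :: "'a \<Rightarrow> real"
  assumes f: "integrable M f" and g: "integrable M g"
    and nn: "\<And>x. f x \<ge> 0" "\<And>x. g x \<ge> 0" and ab: "\<alpha> > 0" "\<beta> > 0" "\<alpha> + \<beta> = 1"
  shows "integrable M (\<lambda>x. f x powr \<alpha> * g x powr \<beta>)"
    and "(\<integral>x. f x powr \<alpha> * g x powr \<beta> \<partial>M) \<le> (\<integral>x. f x \<partial>M) powr \<alpha> * (\<integral>x. g x \<partial>M) powr \<beta>"
proof -
  have [measurable]: "f \<in> borel_measurable M" "g \<in> borel_measurable M" using f g by auto
  show int: "integrable M (\<lambda>x. f x powr \<alpha> * g x powr \<beta>)"
    by (rule Bochner_Integration.integrable_bound[where f = "\<lambda>x. \<alpha> * f x + \<beta> * g x"])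
      (use f g weighted_AM_GM[OF ab] nn in \<open>auto intro!: AE_I2 intro: order_trans[OF _ abs_ge_self]\<close>)
  let ?F = "\<integral>x. f x \<partial>M" and ?G = "\<integral>x. g x \<partial>M"
  have FG: "?F \<ge> 0" "?G \<ge> 0" using nn by auto
  consider "?F = 0" | "?G = 0" | "?F > 0" "?G > 0" using FG by fastforce
  then show "(\<integral>x. f x powr \<alpha> * g x powr \<beta> \<partial>M) \<le> ?F powr \<alpha> * ?G powr \<beta>"
  proof cases
    case 1
    then have "AE x in M. f x = 0" using integral_nonneg_eq_0_iff_AE[OF f] nn by auto
    then have "(\<integral>x. f x powr \<alpha> * g x powr \<beta> \<partial>M) = (\<integral>x. 0 \<partial>M)"
      by (intro integral_cong_AE) auto
    then show ?thesis by simp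
  next
    case 2
    then have "AE x in M. g x = 0" using integral_nonneg_eq_0_iff_AE[OF g] nn by auto
    then have "(\<integral>x. f x powr \<alpha> * g x powr \<beta> \<partial>M) = (\<integral>x. 0 \<partial>M)"
      by (intro integral_cong_AE) auto
    then show ?thesis by simp
  next
    case 3
    have "(\<integral>x. f x powr \<alpha> * g x powr \<beta> \<partial>M) / (?F powr \<alpha> * ?G powr \<beta>)
        = (\<integral>x. (f x / ?F) powr \<alpha> * (g x / ?G) powr \<beta> \<partial>M)"
      using 3 nn by (simp add: powr_divide)
    also have "\<dots> \<le> (\<integral>x. \<alpha> * (f x / ?F) + \<beta> * (g x / ?G) \<partial>M)"
    proof (rule integral_mono)
      show "integrable M (\<lambda>x. (f x / ?F) powr \<alpha> * (g x / ?G) powr \<beta>)"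
        using int 3 nn by (simp add: powr_divide)
      show "(f x / ?F) powr \<alpha> * (g x / ?G) powr \<beta> \<le> \<alpha> * (f x / ?F) + \<beta> * (g x / ?G)" for x
        by (rule weighted_AM_GM[OF ab]) (use 3 nn in auto)
    qed (use f g in auto)
    also have "\<dots> = 1" using f g 3 ab by simp
    finally show ?thesis using 3 by (simp add: divide_le_eq)
  qed
qed

text \<open>Lyapunov's inequality: \<open>q \<mapsto> ln (\<integral> \<bar>u\<bar>\<^sup>q)\<close> is convex.\<close>

lemma integral_powr_interpolation:
  fixes u :: "'a \<Rightarrow> real"
  assumes r: "integrable M (\<lambda>x. \<bar>u x\<bar> powr r)" and s: "integrable M (\<lambda>x. \<bar>u x\<bar> powr s)"
    and t: "0 < t" "t < 1"
  defines "q \<equiv> (1 - t) * r + t * s"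
  shows "integrable M (\<lambda>x. \<bar>u x\<bar> powr q)"
    and "(\<integral>x. \<bar>u x\<bar> powr q \<partial>M) \<le> (\<integral>x. \<bar>u x\<bar> powr r \<partial>M) powr (1 - t) * (\<integral>x. \<bar>u x\<bar> powr s \<partial>M) powr t"
proof -
  have "\<bar>u x\<bar> powr q = (\<bar>u x\<bar> powr r) powr (1 - t) * (\<bar>u x\<bar> powr s) powr t" for x
    unfolding q_def powr_powr powr_add[symmetric] by (simp add: mult.commute)
  then show "integrable M (\<lambda>x. \<bar>u x\<bar> powr q)"
    "(\<integral>x. \<bar>u x\<bar> powr q \<partial>M) \<le> (\<integral>x. \<bar>u x\<bar> powr r \<partial>M) powr (1 - t) * (\<integral>x. \<bar>u x\<bar> powr s \<partial>M) powr t"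
    using Holder_integral[OF r s, of "1 - t" t] t by auto
qed

lemma (in finite_measure) integral_powr_mono_exponent:
  fixes u :: "'a \<Rightarrow> real"
  assumes r: "integrable M (\<lambda>x. \<bar>u x\<bar> powr r)" and q: "0 < q" "q < r"
  shows "integrable M (\<lambda>x. \<bar>u x\<bar> powr q)"
    and "(\<integral>x. \<bar>u x\<bar> powr q \<partial>M) \<le> measure M (space M) powr (1 - q / r) * (\<integral>x. \<bar>u x\<bar> powr r \<partial>M) powr (q / r)"
proof -
  have *: "(\<bar>u x\<bar> powr r) powr (q / r) * 1 powr (1 - q / r) = \<bar>u x\<bar> powr q" for x
    using q by (simp add: powr_powr)
  show "integrable M (\<lambda>x. \<bar>u x\<bar> powr q)" "(\<integral>x. \<bar>u x\<bar> powr q \<partial>M)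
      \<le> measure M (space M) powr (1 - q / r) * (\<integral>x. \<bar>u x\<bar> powr r \<partial>M) powr (q / r)"
    using Holder_integral[OF r, of "\<lambda>_. 1" "q / r" "1 - q / r"] q unfolding *
    by (simp_all add: mult.commute)
qed

text \<open>The quotients \<open>R u q\<close> use the conventions that a non-integrable function has integral \<open>0\<close> and
that division by \<open>0\<close> gives \<open>0\<close>. Together they assign to a function of infinite norm the quotient
\<open>0\<close>, the limit of \<open>E u / y\<close> as \<open>y\<close> tends to infinity. So positivity of \<open>\<mu> q\<close> forces all
members of \<open>U\<close> to be integrable to the power \<open>q\<close>, and the comparisons below stay correct at \<open>q = P\<close>.\<close>

theorem (in finite_measure) absolutely_continuous_Inf_quotient:
  fixes U :: "('a \<Rightarrow> real) set" and E :: "('a \<Rightarrow> real) \<Rightarrow> real" and p P :: real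
  defines "R u q \<equiv> E u / (\<integral>x. \<bar>u x\<bar> powr q \<partial>M) powr (p / q)"
  defines "\<mu> q \<equiv> Inf {R u q | u. u \<in> U}"
  assumes p: "p > 0" and P: "P > 1" and V: "measure M (space M) > 0" and "U \<noteq> {}"
    and meas: "\<And>u. u \<in> U \<Longrightarrow> u \<in> borel_measurable M"
    and nz: "\<And>u. u \<in> U \<Longrightarrow> \<not> (AE x in M. u x = 0)"
    and E: "\<And>u. u \<in> U \<Longrightarrow> E u \<ge> 0"
    and pos: "\<And>q. 0 < q \<Longrightarrow> q < P \<Longrightarrow> \<mu> q > 0"
  shows "absolutely_continuous_on_interval 1 P \<mu>"
proof -
  define V where "V = measure M (space M)"
  define I where "I u q = (\<integral>x. \<bar>u x\<bar> powr q \<partial>M)" for u :: "'a \<Rightarrow> real" and q :: real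
  have R: "R u q = E u / I u q powr (p / q)" for u q unfolding R_def I_def ..
  have V0: "V > 0" using V unfolding V_def .
  have R0: "R u q \<ge> 0" if "u \<in> U" for u q using E[OF that] unfolding R by auto
  have lower: "\<mu> q \<le> R u q" if "u \<in> U" for u q
    unfolding \<mu>_def using that R0 by (intro cInf_lower bdd_belowI[of _ 0]) auto
  have greatest: "c \<le> \<mu> q" if "\<And>u. u \<in> U \<Longrightarrow> c \<le> R u q" for c q
    unfolding \<mu>_def using that \<open>U \<noteq> {}\<close> by (intro cInf_greatest) auto
  have \<mu>0: "\<mu> q \<ge> 0" for q using greatest R0 by blast
  have Ipos: "I u q > 0" if "u \<in> U" and int: "integrable M (\<lambda>x. \<bar>u x\<bar> powr q)" for u q
  proof -
    have "I u q \<noteq> 0"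
      using integral_nonneg_eq_0_iff_AE[OF int] nz[OF \<open>u \<in> U\<close>] unfolding I_def by auto
    moreover have "I u q \<ge> 0" unfolding I_def by auto
    ultimately show ?thesis by simp
  qed
  have nonint: "R u q = 0" if "\<not> integrable M (\<lambda>x. \<bar>u x\<bar> powr q)" for u q
    using that unfolding R I_def by (simp add: not_integrable_integral_eq)
  have sub: "integrable M (\<lambda>x. \<bar>u x\<bar> powr q) \<and> E u > 0" if "u \<in> U" "0 < q" "q < P" for u q
  proof -
    have "R u q > 0" using lower[of u q] pos[of q] that by auto
    then show ?thesis using nonint[of u q] E[OF \<open>u \<in> U\<close>] unfolding R
      by (metis less_eq_real_def less_irrefl div_0)
  qed

  have anti: "V powr (p / r) * \<mu> r \<le> V powr (p / q) * \<mu> q" if qr: "0 < q" "q < r" for q r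
  proof -
    have "V powr (p / r - p / q) * \<mu> r \<le> \<mu> q"
    proof (rule greatest)
      fix u assume u: "u \<in> U"
      show "V powr (p / r - p / q) * \<mu> r \<le> R u q"
      proof (cases "integrable M (\<lambda>x. \<bar>u x\<bar> powr r)")
        case False
        then have "\<mu> r = 0" using nonint lower[OF u, of r] \<mu>0[of r] by force
        then show ?thesis using R0[OF u] by simp
      next
        case True
        note m = integral_powr_mono_exponent[OF True qr]
        have Iq: "I u q > 0" using Ipos[OF u m(1)] .
        have Ir: "I u r > 0" using Ipos[OF u True] .
        have "I u q powr (p / q) \<le> (V powr (1 - q / r) * I u r powr (q / r)) powr (p / q)"
          using m(2) Iq p qr unfolding I_def V_def by (intro powr_mono2) auto
        also have "\<dots> = V powr (p / q - p / r) * I u r powr (p / r)"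
          using qr by (simp add: powr_mult powr_powr field_simps)
        finally have le: "I u q powr (p / q) \<le> V powr (p / q - p / r) * I u r powr (p / r)" .
        have "V powr (p / r - p / q) * \<mu> r \<le> V powr (p / r - p / q) * R u r"
          using lower[OF u] by (intro mult_left_mono) auto
        also have "\<dots> = E u / (V powr (p / q - p / r) * I u r powr (p / r))"
          using V0 unfolding R by (simp add: powr_diff field_simps)
        also have "\<dots> \<le> R u q"
          unfolding R using le Iq Ir V0 E[OF u] by (intro divide_left_mono) auto
        finally show ?thesis .
      qed
    qed
    then have "V powr (p / q) * (V powr (p / r - p / q) * \<mu> r) \<le> V powr (p / q) * \<mu> q"
      by (intro mult_left_mono) auto
    then show ?thesis using V0 by (simp add: mult.assoc[symmetric] powr_add[symmetric])
  qed

  have conc: "concave_on {0<..<P} (\<lambda>q. q * ln (\<mu> q))"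
  proof (rule concave_on_linorderI)
    fix t r s :: real
    assume t: "0 < t" "t < 1" and rs: "r \<in> {0<..<P}" "s \<in> {0<..<P}"
    define q where "q = (1 - t) * r + t * s"
    define S where "S = (1 - t) * (r * ln (\<mu> r)) + t * (s * ln (\<mu> s))"
    have q: "0 < q" "q < P"
    proof -
      show "0 < q" unfolding q_def using t rs by (intro add_pos_pos) auto
      have "q < (1 - t) * P + t * P"
        unfolding q_def using t rs by (intro add_strict_mono) auto
      then show "q < P" by (simp add: algebra_simps)
    qed
    have "exp (S / q) \<le> \<mu> q"
    proof (rule greatest)
      fix u assume u: "u \<in> U"
      have r': "integrable M (\<lambda>x. \<bar>u x\<bar> powr r)" and s': "integrable M (\<lambda>x. \<bar>u x\<bar> powr s)"
        and E0: "E u > 0" using sub[OF u] rs by auto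
      note ip = integral_powr_interpolation[OF r' s' t, folded q_def I_def]
      have I0: "I u r > 0" "I u s > 0" "I u q > 0" using Ipos[OF u] r' s' ip(1) by auto
      have lnR: "v * ln (R u v) = v * ln (E u) - p * ln (I u v)" if "v > 0" "I u v > 0" for v
        unfolding R using that E0 by (simp add: ln_div ln_powr algebra_simps)
      have le: "v * ln (\<mu> v) \<le> v * ln (R u v)" if "v \<in> {0<..<P}" for v
        using that lower[OF u, of v] pos[of v] by (intro mult_left_mono) auto
      have "ln (I u q) \<le> (1 - t) * ln (I u r) + t * ln (I u s)"
      proof -
        have "ln (I u q) \<le> ln (I u r powr (1 - t) * I u s powr t)"
          using ip(2) I0 by simp
        then show ?thesis using I0 by (simp add: ln_mult ln_powr)
      qed
      then have *: "p * ln (I u q) \<le> p * ((1 - t) * ln (I u r) + t * ln (I u s))"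
        using p by (intro mult_left_mono) auto
      have "S \<le> (1 - t) * (r * ln (R u r)) + t * (s * ln (R u s))"
        unfolding S_def using le rs t by (intro add_mono mult_left_mono) auto
      also have "\<dots> = q * ln (E u) - p * ((1 - t) * ln (I u r) + t * ln (I u s))"
      proof -
        have eqs: "r * ln (R u r) = r * ln (E u) - p * ln (I u r)"
          "s * ln (R u s) = s * ln (E u) - p * ln (I u s)"
          using lnR I0 rs by auto
        show ?thesis unfolding eqs q_def by (simp add: algebra_simps)
      qed
      also have "\<dots> \<le> q * ln (R u q)" using * lnR I0 q by simp
      finally have "S / q \<le> ln (R u q)" using q by (simp add: divide_le_eq mult.commute)
      moreover have "R u q > 0" unfolding R using E0 I0 by simp
      ultimately show "exp (S / q) \<le> R u q" by (simp add: ln_ge_iff)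
    qed
    then have "S / q \<le> ln (\<mu> q)" using pos[OF q] by (simp add: ln_ge_iff)
    then have "S \<le> q * ln (\<mu> q)" using q by (simp add: divide_le_eq mult.commute)
    then show "(1 - t) * (r * ln (\<mu> r)) + t * (s * ln (\<mu> s))
      \<le> ((1 - t) *\<^sub>R r + t *\<^sub>R s) * ln (\<mu> ((1 - t) *\<^sub>R r + t *\<^sub>R s))"
      unfolding S_def q_def by simp
  qed auto

  have lim: "\<exists>q. 1 \<le> q \<and> q < P \<and> V powr (p / q) * \<mu> q < V powr (p / P) * \<mu> P + \<epsilon>"
    if "\<epsilon> > 0" for \<epsilon>
  proof (rule ccontr)
    define m where "m = V powr (p / P) * \<mu> P + \<epsilon>"
    assume "\<not> ?thesis"
    then have ge: "m \<le> V powr (p / q) * \<mu> q" if "1 \<le> q" "q < P" for q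
      using that unfolding m_def by force
    have m0: "m > 0" unfolding m_def using \<mu>0[of P] V0 \<open>\<epsilon> > 0\<close> by (intro add_nonneg_pos) auto
    have "m / V powr (p / P) \<le> \<mu> P"
    proof (rule greatest)
      fix u assume u: "u \<in> U"
      have E0: "E u > 0" using sub[OF u, of 1] P by auto
      \<comment> \<open>a sequence in \<open>[1, P)\<close> that tends to \<open>P\<close>\<close>
      define q where "q n = P - (P - 1) / real (Suc n)" for n
      have q: "1 \<le> q n" "q n < P" for n
      proof -
        have "(P - 1) / real (Suc n) \<le> (P - 1) / 1" using P by (intro divide_left_mono) auto
        then show "1 \<le> q n" unfolding q_def by simp
        show "q n < P" unfolding q_def using P by simp
      qed
      have q_lim: "q \<longlonglongrightarrow> P"
        unfolding q_def
        using tendsto_diff[OF tendsto_const LIMSEQ_Suc[OF lim_const_over_n[of "P - 1"]], of P] by simp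
      have Ile: "I u r \<le> V * (E u / m) powr (r / p)" if r: "1 \<le> r" "r < P" for r
      proof -
        have I0: "I u r > 0" using Ipos[OF u] sub[OF u, of r] r by auto
        have "m \<le> V powr (p / r) * R u r"
          using ge[OF r] lower[OF u, of r] by (meson mult_left_mono order_trans powr_ge_zero)
        then have "I u r powr (p / r) \<le> V powr (p / r) * (E u / m)"
          unfolding R using I0 m0 by (simp add: field_simps)
        then have "(I u r powr (p / r)) powr (r / p) \<le> (V powr (p / r) * (E u / m)) powr (r / p)"
          using r p by (intro powr_mono2) auto
        then show ?thesis using r p V0 E0 m0 I0 by (simp add: powr_mult powr_divide powr_powr)
      qed
      have *: "integrable M (\<lambda>x. \<bar>u x\<bar> powr P) \<and> (\<integral>x. \<bar>u x\<bar> powr P \<partial>M) \<le> V * (E u / m) powr (P / p)"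
      proof (rule integrable_Fatou[where f = "\<lambda>n x. \<bar>u x\<bar> powr q n" and c = "\<lambda>n. V * (E u / m) powr (q n / p)"])
        show "(\<lambda>x. \<bar>u x\<bar> powr P) \<in> borel_measurable M" using meas[OF u] by measurable
        show "AE x in M. (\<lambda>n. \<bar>u x\<bar> powr q n) \<longlonglongrightarrow> \<bar>u x\<bar> powr P"
        proof (rule AE_I2)
          show "(\<lambda>n. \<bar>u x\<bar> powr q n) \<longlonglongrightarrow> \<bar>u x\<bar> powr P" for x
            using q_lim by (cases "u x = 0") (auto intro!: tendsto_powr)
        qed
        show "(\<lambda>n. V * (E u / m) powr (q n / p)) \<longlonglongrightarrow> V * (E u / m) powr (P / p)"
          using q_lim E0 m0 p by (intro tendsto_intros) auto
        show "integrable M (\<lambda>x. \<bar>u x\<bar> powr q n)" for n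
          using sub[OF u, of "q n"] q[of n] by auto
        show "(\<integral>x. \<bar>u x\<bar> powr q n \<partial>M) \<le> V * (E u / m) powr (q n / p)" for n
          using Ile[OF q] unfolding I_def .
      qed auto
      have IP: "I u P > 0" using Ipos[OF u conjunct1[OF *]] .
      have "I u P powr (p / P) \<le> (V * (E u / m) powr (P / p)) powr (p / P)"
        using * IP p P unfolding I_def by (intro powr_mono2) auto
      also have "\<dots> = V powr (p / P) * (E u / m)"
        using V0 E0 m0 p P by (simp add: powr_mult powr_powr)
      finally show "m / V powr (p / P) \<le> R u P"
        unfolding R using V0 E0 m0 IP by (simp add: field_simps)
    qed
    then have "m \<le> V powr (p / P) * \<mu> P" using V0 by (simp add: field_simps)
    then show False unfolding m_def using \<open>\<epsilon> > 0\<close> by simp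
  qed
  show ?thesis
    by (rule absolutely_continuous_of_log_concave[OF P V0 pos \<mu>0 conc _ lim])
      (auto intro!: monotone_onI, metis anti less_eq_real_def)
qed

section \<open>Smooth bump functions\<close>

lemma frechet_derivative_eqI: "(f has_derivative f') (at x) \<Longrightarrow> frechet_derivative f (at x) = f'"
  using frechet_derivative_at by metis

lemma Ck_on_SucD: "Ck_on (Suc k) UNIV f \<Longrightarrow> Ck_on k UNIV f"
proof (induction k arbitrary: f)
  case 0
  then show ?case
    by (auto intro!: continuous_at_imp_continuous_on differentiable_imp_continuous_within)
next
  case (Suc k)
  then show ?case by (metis Ck_on.simps(2))
qed

lemma Ck_on_const: "Ck_on k UNIV (\<lambda>_. c)"
proof (induction k arbitrary: c)
  case (Suc k)
  have "frechet_derivative (\<lambda>_. c) (at x) = (\<lambda>_. 0)" for x :: 'a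
    by (rule frechet_derivative_eqI) (rule has_derivative_const)
  then show ?case using Suc by simp
qed simp

lemma Ck_on_add:
  "Ck_on k UNIV f \<Longrightarrow> Ck_on k UNIV g \<Longrightarrow> Ck_on k UNIV (\<lambda>x. f x + g x)"
proof (induction k arbitrary: f g)
  case (Suc k)
  then have d: "\<And>x. (f has_derivative frechet_derivative f (at x)) (at x)"
    "\<And>x. (g has_derivative frechet_derivative g (at x)) (at x)"
    by (auto simp: frechet_derivative_works)
  have "frechet_derivative (\<lambda>x. f x + g x) (at x) = (\<lambda>i. frechet_derivative f (at x) i + frechet_derivative g (at x) i)" for x
    by (rule frechet_derivative_eqI) (intro has_derivative_add d)
  then show ?case using Suc by auto
qed (auto intro: continuous_on_add)

lemma Ck_on_mult:
  "Ck_on k UNIV f \<Longrightarrow> Ck_on k UNIV g \<Longrightarrow> Ck_on k UNIV (\<lambda>x. f x * g x)"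
proof (induction k arbitrary: f g)
  case (Suc k)
  then have d: "\<And>x. (f has_derivative frechet_derivative f (at x)) (at x)"
    "\<And>x. (g has_derivative frechet_derivative g (at x)) (at x)"
    by (auto simp: frechet_derivative_works)
  have "frechet_derivative (\<lambda>x. f x * g x) (at x) = (\<lambda>i. f x * frechet_derivative g (at x) i + frechet_derivative f (at x) i * g x)" for x
    by (rule frechet_derivative_eqI) (intro has_derivative_mult d)
  moreover have "Ck_on k UNIV f" "Ck_on k UNIV g" using Suc.prems Ck_on_SucD by auto
  ultimately show ?case using Suc by (auto intro!: Ck_on_add)
qed (auto intro: continuous_on_mult)

lemma Ck_on_prod:
  "finite I \<Longrightarrow> (\<And>i. i \<in> I \<Longrightarrow> Ck_on k UNIV (f i)) \<Longrightarrow> Ck_on k UNIV (\<lambda>x. \<Prod>i\<in>I. f i x)"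
  by (induction I rule: finite_induct) (auto intro: Ck_on_const Ck_on_mult)

text \<open>The sequence \<open>d\<close> lists the successive derivatives of a smooth function of one variable.\<close>

lemma Ck_on_compose_affine:
  fixes d :: "nat \<Rightarrow> real \<Rightarrow> real"
  assumes d: "\<And>n t. (d n has_real_derivative d (Suc n) t) (at t)"
  shows "Ck_on k UNIV (\<lambda>x. d n (x \<bullet> v + b))"
proof (induction k arbitrary: n)
  case 0
  have "isCont (d n) t" for t using d DERIV_isCont by blast
  then have "continuous_on UNIV (d n)" by (simp add: continuous_at_imp_continuous_on)
  then show ?case
    by (auto intro!: continuous_on_compose2[of UNIV "d n"] continuous_intros)
next
  case (Suc k)
  have der: "((\<lambda>x. d n (x \<bullet> v + b)) has_derivative (\<lambda>i. d (Suc n) (x \<bullet> v + b) * (i \<bullet> v))) (at x)" for x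
    by (rule has_derivative_eq_rhs[OF has_derivative_compose[OF _ d[of n, unfolded has_field_derivative_def]]])
      (auto intro!: derivative_eq_intros)
  have "frechet_derivative (\<lambda>x. d n (x \<bullet> v + b)) (at x) = (\<lambda>i. d (Suc n) (x \<bullet> v + b) * (i \<bullet> v))" for x
    by (rule frechet_derivative_eqI[OF der])
  then show ?case using Suc der by (auto intro!: Ck_on_mult Ck_on_const simp: differentiable_def)
qed

text \<open>Smoothness of the function \<open>exp (- 1 / t)\<close>, extended by \<open>0\<close>, is proved for this family, which is
closed under differentiation.\<close>

definition flat :: "real poly \<Rightarrow> real \<Rightarrow> real" where
  "flat P t = (if t > 0 then poly P (1 / t) * exp (- 1 / t) else 0)"

lemma poly_div_exp_tendsto_0:
  fixes P :: "real poly"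
  shows "((\<lambda>y. poly P y * exp (- y)) \<longlongrightarrow> 0) at_top"
proof -
  have "((\<lambda>y. \<Sum>i\<le>degree P. coeff P i * (y ^ i / exp y)) \<longlongrightarrow> (\<Sum>i\<le>degree P. coeff P i * 0)) at_top"
    by (intro tendsto_sum tendsto_mult tendsto_const tendsto_power_div_exp_0)
  then show ?thesis
    by (simp add: poly_altdef sum_distrib_right exp_minus divide_inverse mult.assoc)
qed

text \<open>For \<open>t > 0\<close> this is \<open>(P(1/t))' = - P'(1/t) / t\<^sup>2\<close> and \<open>(exp (- 1/t))' = exp (- 1/t) / t\<^sup>2\<close>; at \<open>0\<close> the
exponential beats every power of \<open>1 / t\<close>.\<close>

lemma flat_has_derivative:
  "(flat P has_real_derivative flat ([:0, 0, 1:] * (P - pderiv P)) t) (at t)"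
proof -
  consider "t > 0" | "t < 0" | "t = 0" by linarith
  then show ?thesis
  proof cases
    case 1
    have "((\<lambda>t. poly P (1 / t) * exp (- 1 / t)) has_real_derivative
        flat ([:0, 0, 1:] * (P - pderiv P)) t) (at t)"
      using 1 unfolding flat_def
      by (auto intro!: derivative_eq_intros DERIV_chain2[OF poly_DERIV] simp: field_simps power2_eq_square)
    then show ?thesis
    proof (rule has_field_derivative_transform_within_open[where S = "{0<..}"])
    qed (use 1 in \<open>auto simp: flat_def\<close>)
  next
    case 2
    have "((\<lambda>t. 0) has_real_derivative flat ([:0, 0, 1:] * (P - pderiv P)) t) (at t)"
      using 2 unfolding flat_def by auto
    then show ?thesis
    proof (rule has_field_derivative_transform_within_open[where S = "{..<0}"])
    qed (use 2 in \<open>auto simp: flat_def\<close>)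
  next
    case 3
    have "((\<lambda>t. poly ([:0, 1:] * P) (inverse t) * exp (- inverse t)) \<longlongrightarrow> 0) (at_right 0)"
      by (rule filterlim_compose[OF poly_div_exp_tendsto_0 filterlim_inverse_at_top_right])
    then have "((\<lambda>t. flat P t / t) \<longlongrightarrow> 0) (at_right 0)"
      by (rule Lim_transform_eventually)
        (auto simp: eventually_at_filter flat_def divide_inverse)
    moreover have "((\<lambda>t. flat P t / t) \<longlongrightarrow> 0) (at_left 0)"
      by (rule Lim_transform_eventually[OF tendsto_const])
        (auto simp: eventually_at_filter flat_def)
    ultimately have "((\<lambda>t. flat P t / t) \<longlongrightarrow> 0) (at 0)"
      by (simp add: filterlim_split_at)
    then show ?thesis using 3 unfolding has_field_derivative_iff by (simp add: flat_def)
  qed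
qed

lemma Ck_on_flat_affine: "Ck_on k UNIV (\<lambda>x. flat P (x \<bullet> v + b))"
proof -
  define d where "d n = flat (((\<lambda>P. [:0, 0, 1:] * (P - pderiv P)) ^^ n) P)" for n
  have "(d n has_real_derivative d (Suc n) t) (at t)" for n t
    unfolding d_def using flat_has_derivative by simp
  from Ck_on_compose_affine[where d = d, OF this, of k 0 v b] show ?thesis unfolding d_def by simp
qed

text \<open>Scaling the argument of \<open>exp (- 1 / t)\<close> by \<open>n + 1\<close> keeps the support in the box and
makes the bumps converge to its indicator function.\<close>

definition box_bump :: "'a::euclidean_space \<Rightarrow> 'a \<Rightarrow> nat \<Rightarrow> 'a \<Rightarrow> real" where
  "box_bump a b n x =
     (\<Prod>i\<in>Basis. flat 1 (real (Suc n) * (x \<bullet> i - a \<bullet> i)) * flat 1 (real (Suc n) * (b \<bullet> i - x \<bullet> i)))"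

lemma box_bump_test_function:
  assumes "cbox a b \<subseteq> \<Omega>"
  shows "box_bump a b n \<in> test_functions \<Omega>"
proof -
  have "Ck_on k UNIV (box_bump a b n)" for k
  proof -
    have "flat 1 (real (Suc n) * (x \<bullet> i - a \<bullet> i)) = flat 1 (x \<bullet> (real (Suc n) *\<^sub>R i) + - real (Suc n) * (a \<bullet> i))"
      "flat 1 (real (Suc n) * (b \<bullet> i - x \<bullet> i)) = flat 1 (x \<bullet> (- real (Suc n) *\<^sub>R i) + real (Suc n) * (b \<bullet> i))" for x i
      by (simp_all add: algebra_simps)
    then show ?thesis unfolding box_bump_def[abs_def]
      by (intro Ck_on_prod Ck_on_mult) (simp_all only: Ck_on_flat_affine finite_Basis)
  qed
  moreover have "box_bump a b n x = 0" if x: "x \<notin> cbox a b" for x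
  proof -
    obtain i where i: "i \<in> Basis" "\<not> (a \<bullet> i \<le> x \<bullet> i \<and> x \<bullet> i \<le> b \<bullet> i)"
      using x unfolding mem_box by blast
    have flat0: "flat 1 (real (Suc n) * t) = 0" if "t < 0" for t :: real
      using that mult_pos_neg[of "real (Suc n)" t] by (simp add: flat_def)
    have "flat 1 (real (Suc n) * (x \<bullet> i - a \<bullet> i)) * flat 1 (real (Suc n) * (b \<bullet> i - x \<bullet> i)) = 0"
      using i(2) flat0[of "x \<bullet> i - a \<bullet> i"] flat0[of "b \<bullet> i - x \<bullet> i"]
      by (auto simp only: not_le de_Morgan_conj diff_less_0_iff_less mult_eq_0_iff)
    then show ?thesis unfolding box_bump_def using i(1) by (intro prod_zero finite_Basis bexI[of _ i])
  qed
  ultimately show ?thesis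
    unfolding test_functions_def smooth_on_def using assms
    by (intro CollectI conjI allI exI[of _ "cbox a b"] compact_cbox) auto
qed

lemma box_bump_bounds: "0 \<le> box_bump a b n x" "box_bump a b n x \<le> 1"
proof -
  have f: "0 \<le> flat 1 t" "flat 1 t \<le> 1" for t :: real by (auto simp: flat_def)
  then show "0 \<le> box_bump a b n x" unfolding box_bump_def by (intro prod_nonneg) auto
  show "box_bump a b n x \<le> 1"
    unfolding box_bump_def using f by (intro prod_le_1) (auto intro!: mult_le_one)
qed

lemma box_bump_tendsto: "(\<lambda>n. box_bump a b n x) \<longlonglongrightarrow> indicator (box a b) x"
proof -
  have lim: "(\<lambda>n. flat 1 (real (Suc n) * t)) \<longlonglongrightarrow> (if t > 0 then 1 else 0)" for t :: real
  proof (cases "t > 0")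
    case True
    have "(\<lambda>n. (1 / t) / real n) \<longlonglongrightarrow> 0" by (rule lim_const_over_n)
    then have "(\<lambda>n. (1 / t) / real (Suc n)) \<longlonglongrightarrow> 0" by (rule LIMSEQ_Suc)
    then have "(\<lambda>n. exp (- ((1 / t) / real (Suc n)))) \<longlonglongrightarrow> exp (- 0)" by (intro tendsto_intros)
    then show ?thesis using True by (simp add: flat_def mult.commute)
  next
    case False
    then have "flat 1 (real (Suc n) * t) = 0" for n by (simp add: flat_def zero_less_mult_iff)
    then show ?thesis using False by simp
  qed
  have "(\<lambda>n. box_bump a b n x) \<longlonglongrightarrow>
    (\<Prod>i\<in>Basis. (if x \<bullet> i - a \<bullet> i > 0 then 1 else 0) * (if b \<bullet> i - x \<bullet> i > 0 then 1 else 0))"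
    unfolding box_bump_def by (intro tendsto_prod tendsto_mult lim)
  moreover have "(\<Prod>i\<in>Basis. (if x \<bullet> i - a \<bullet> i > 0 then 1 else 0) * (if b \<bullet> i - x \<bullet> i > 0 then 1 else 0))
      = (indicator (box a b) x :: real)"
    by (cases "x \<in> box a b") (auto simp: mem_box intro!: prod.neutral)
  ultimately show ?thesis by simp
qed

section \<open>The fundamental lemma of the calculus of variations\<close>

text \<open>Test with the bump functions of the box and pass to the limit by dominated convergence.\<close>

lemma integral_cbox_eq_0_if_test_functions:
  fixes h :: "'a::euclidean_space \<Rightarrow> real"
  assumes \<Omega>: "open \<Omega>" and h: "h locally_integrable_on \<Omega>"
    and test: "\<And>\<phi>. \<phi> \<in> test_functions \<Omega> \<Longrightarrow> (LINT x|lebesgue_on \<Omega>. h x * \<phi> x) = 0"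
    and K: "cbox a b \<subseteq> \<Omega>"
  shows "integral (cbox a b) h = 0"
proof -
  have abs: "h absolutely_integrable_on cbox a b"
    using h K unfolding locally_integrable_on_def by auto
  then have H: "integrable lebesgue (\<lambda>x. indicat_real (cbox a b) x * h x)"
    by (simp add: set_integrable_def)
  have eq: "(LINT x|lebesgue. (indicat_real (cbox a b) x * h x) * box_bump a b n x) = 0" for n
  proof -
    have bump: "box_bump a b n \<in> test_functions (cbox a b)" "box_bump a b n \<in> test_functions \<Omega>"
      using K by (auto intro: box_bump_test_function)
    then have "box_bump a b n x = 0" if "x \<notin> cbox a b" for x
      using that unfolding test_functions_def by blast
    then have "(LINT x|lebesgue. (indicat_real (cbox a b) x * h x) * box_bump a b n x)
        = (LINT x|lebesgue. indicat_real \<Omega> x *\<^sub>R (h x * box_bump a b n x))"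
      using K by (intro Bochner_Integration.integral_cong) (auto simp: indicator_def)
    also have "\<dots> = 0"
      using test[OF bump(2)] \<Omega> by (subst (asm) integral_restrict_space) auto
    finally show ?thesis .
  qed
  have meas: "box_bump a b n \<in> borel_measurable lebesgue" for n
  proof -
    have "Ck_on 0 UNIV (box_bump a b n)"
      using box_bump_test_function[OF order_refl] unfolding test_functions_def smooth_on_def by blast
    then show ?thesis
      by (auto intro!: measurable_completion borel_measurable_continuous_onI)
  qed
  have "(\<lambda>n. LINT x|lebesgue. (indicat_real (cbox a b) x * h x) * box_bump a b n x) \<longlonglongrightarrow>
      (LINT x|lebesgue. (indicat_real (cbox a b) x * h x) * indicator (box a b) x)"
  proof (rule integral_dominated_convergence[where w = "\<lambda>x. \<bar>indicat_real (cbox a b) x * h x\<bar>"])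
    show "AE x in lebesgue. norm (indicat_real (cbox a b) x * h x * box_bump a b n x)
        \<le> \<bar>indicat_real (cbox a b) x * h x\<bar>" for n
      using box_bump_bounds[of a b n] by (auto simp: abs_mult intro!: AE_I2 mult_left_le)
    show "(\<lambda>x. (indicat_real (cbox a b) x * h x) * indicator (box a b) x) \<in> borel_measurable lebesgue"
      using H by (intro borel_measurable_times borel_measurable_integrable borel_measurable_indicator) auto
  qed (use H meas in \<open>auto intro!: AE_I2 tendsto_mult box_bump_tendsto\<close>)
  then have "(LINT x|lebesgue. (indicat_real (cbox a b) x * h x) * indicator (box a b) x) = 0"
    unfolding eq by (simp add: LIMSEQ_const_iff)
  also have "(LINT x|lebesgue. (indicat_real (cbox a b) x * h x) * indicator (box a b) x)
      = set_lebesgue_integral lebesgue (box a b) h"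
    unfolding set_lebesgue_integral_def using box_subset_cbox[of a b]
    by (intro Bochner_Integration.integral_cong) (auto simp: indicator_def)
  also have "\<dots> = integral (box a b) h"
    using abs by (intro set_lebesgue_integral_eq_integral) (simp add: absolutely_integrable_on_open_interval)
  finally show ?thesis by (simp add: integral_open_interval)
qed

text \<open>The integrals of \<open>h\<close> over all small boxes vanish, and by Lebesgue differentiation almost every value
of \<open>h\<close> is a limit of averages over such boxes. The open set is covered by countably many closed boxes,
which reduces the claim to a function that is integrable on the whole box.\<close>

theorem AE_eq_0_if_test_functions:
  fixes h :: "'a::euclidean_space \<Rightarrow> real"
  assumes \<Omega>: "open \<Omega>" and h: "h locally_integrable_on \<Omega>"
    and test: "\<And>\<phi>. \<phi> \<in> test_functions \<Omega> \<Longrightarrow> (LINT x|lebesgue_on \<Omega>. h x * \<phi> x) = 0"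
  shows "AE x in lebesgue_on \<Omega>. h x = 0"
proof -
  have neg: "negligible {x \<in> cbox a b. h x \<noteq> 0}" if K: "cbox a b \<subseteq> \<Omega>" for a b
  proof -
    define f where "f x = (if x \<in> cbox a b then h x else 0)" for x
    have "h absolutely_integrable_on cbox a b"
      using h K unfolding locally_integrable_on_def by auto
    then have "f absolutely_integrable_on UNIV"
      unfolding f_def absolutely_integrable_restrict_UNIV .
    then have "f integrable_on UNIV" by (simp add: absolutely_integrable_on_def)
    then have f: "f integrable_on cbox c d" for c d by (rule integrable_on_subcbox) auto
    obtain N where N: "negligible N" and lim: "\<And>x e. x \<notin> N \<Longrightarrow> 0 < e \<Longrightarrow>
       \<exists>d>0. \<forall>r. 0 < r \<and> r < d \<longrightarrow> norm (integral (cbox x (x + r *\<^sub>R One)) f /\<^sub>R r ^ DIM('a) - f x) < e"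
      using integrable_ccontinuous_explicit[OF f] by metis
    have "h x = 0" if x: "x \<in> box a b" "x \<notin> N" for x
    proof (rule ccontr)
      assume "h x \<noteq> 0"
      moreover have "f x = h x" using x box_subset_cbox[of a b] unfolding f_def by auto
      ultimately have f0: "\<bar>f x\<bar> > 0" by simp
      obtain d where d: "d > 0" "\<And>r. 0 < r \<and> r < d \<Longrightarrow>
          norm (integral (cbox x (x + r *\<^sub>R One)) f /\<^sub>R r ^ DIM('a) - f x) < \<bar>f x\<bar>"
        using lim[OF x(2) f0] by (elim exE conjE) (rule that, assumption, simp)
      obtain e where e: "e > 0" "cball x e \<subseteq> box a b"
        using x(1) open_box[of a b] by (metis open_contains_cball)
      \<comment> \<open>a cube of side \<open>r\<close> lies in a ball of radius \<open>r * DIM('a)\<close>\<close>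
      define r where "r = min (d / 2) (e / DIM('a))"
      have r: "0 < r" "r < d" "r \<le> e / DIM('a)" using d e unfolding r_def by auto
      have "cbox x (x + r *\<^sub>R One) \<subseteq> cball x e"
      proof
        fix y assume y: "y \<in> cbox x (x + r *\<^sub>R One)"
        have "norm (y - x) \<le> (\<Sum>i\<in>Basis. \<bar>(y - x) \<bullet> i\<bar>)" by (rule norm_le_l1)
        also have "\<dots> \<le> (\<Sum>i\<in>(Basis :: 'a set). r)"
          using y by (intro sum_mono) (auto simp: mem_box inner_diff_left inner_add_left)
        also have "\<dots> = DIM('a) * r" by simp
        also have "\<dots> \<le> DIM('a) * (e / DIM('a))" using r by (intro mult_left_mono) auto
        also have "\<dots> = e" by simp
        finally show "y \<in> cball x e" by (simp add: dist_norm norm_minus_commute)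
      qed
      then have sub: "cbox x (x + r *\<^sub>R One) \<subseteq> cbox a b" using e box_subset_cbox[of a b] by blast
      have "integral (cbox x (x + r *\<^sub>R One)) f = integral (cbox x (x + r *\<^sub>R One)) h"
        by (rule Henstock_Kurzweil_Integration.integral_cong) (use sub in \<open>auto simp: f_def\<close>)
      also have "\<dots> = 0"
        by (rule integral_cbox_eq_0_if_test_functions[OF \<Omega> h test]) (use sub K in auto)
      finally show False using d(2)[of r] r by simp
    qed
    then have "{x \<in> cbox a b. h x \<noteq> 0} \<subseteq> N \<union> (cbox a b - box a b)" by auto
    then show ?thesis
      using N negligible_frontier_interval by (meson negligible_Un negligible_subset)
  qed
  obtain D where D: "countable D" "\<And>X. X \<in> D \<Longrightarrow> \<exists>a b. X = cbox a b" "\<Union>D = \<Omega>"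
    using open_countable_Union_open_cbox[OF \<Omega>] by metis
  have "negligible (\<Union>X\<in>D. {x \<in> X. h x \<noteq> 0})"
  proof (rule negligible_countable_Union)
    show "negligible A" if A: "A \<in> (\<lambda>X. {x \<in> X. h x \<noteq> 0}) ` D" for A
    proof -
      obtain X where X: "X \<in> D" "A = {x \<in> X. h x \<noteq> 0}" using A by blast
      obtain a b where ab: "X = cbox a b" using D(2)[OF X(1)] by blast
      have "cbox a b \<subseteq> \<Omega>" using X(1) D(3) ab by blast
      from neg[OF this] show ?thesis unfolding X(2) ab .
    qed
  qed (use D(1) in \<open>rule countable_image\<close>)
  then have "(\<Union>X\<in>D. {x \<in> X. h x \<noteq> 0}) \<in> null_sets lebesgue"
    by (simp add: negligible_iff_null_sets)
  then have "AE x in lebesgue. x \<in> \<Omega> \<longrightarrow> h x = 0"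
    by (rule AE_I') (use D(3) in blast)
  then show ?thesis
    using \<Omega> by (simp add: AE_restrict_space_iff)
qed

section \<open>Weak gradients of test functions\<close>

lemma test_function_has_derivative:
  "\<phi> \<in> test_functions \<Omega> \<Longrightarrow> (\<phi> has_derivative frechet_derivative \<phi> (at x)) (at x)"
  using frechet_derivative_works unfolding test_functions_def smooth_on_def
  by (metis (mono_tags, lifting) Ck_on.simps(2) UNIV_I mem_Collect_eq)

lemma test_function_support:
  assumes "\<phi> \<in> test_functions \<Omega>"
  obtains K where "compact K" "K \<subseteq> \<Omega>" "\<And>x. x \<notin> K \<Longrightarrow> \<phi> x = 0"
  using assms unfolding test_functions_def by blast

lemma test_function_continuous: "\<phi> \<in> test_functions \<Omega> \<Longrightarrow> continuous_on UNIV \<phi>"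
  using Ck_on.simps(1) unfolding test_functions_def smooth_on_def by blast

lemma test_function_partial:
  fixes \<phi> :: "'a::euclidean_space \<Rightarrow> real"
  assumes \<phi>: "\<phi> \<in> test_functions \<Omega>" and i: "i \<in> Basis"
  shows "(\<lambda>x. frechet_derivative \<phi> (at x) i) \<in> test_functions \<Omega>"
proof -
  obtain K where K: "compact K" "K \<subseteq> \<Omega>" "\<And>x. x \<notin> K \<Longrightarrow> \<phi> x = 0"
    using test_function_support[OF \<phi>] by blast
  have "Ck_on k UNIV (\<lambda>x. frechet_derivative \<phi> (at x) i)" for k
  proof -
    have "Ck_on (Suc k) UNIV \<phi>" using \<phi> unfolding test_functions_def smooth_on_def by blast
    then show ?thesis using i by simp
  qed
  moreover have "frechet_derivative \<phi> (at x) i = 0" if x: "x \<notin> K" for x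
  proof -
    have "(\<phi> has_derivative (\<lambda>_. 0)) (at x)"
    proof (rule has_derivative_transform_within_open[of "\<lambda>_. 0"])
      show "open (- K)" using K(1) by (simp add: compact_imp_closed open_Compl)
    qed (use x K(3) in auto)
    from frechet_derivative_eqI[OF this] show ?thesis by simp
  qed
  ultimately show ?thesis
    unfolding test_functions_def smooth_on_def using K(1,2) by blast
qed

lemma test_function_mult:
  assumes \<phi>: "\<phi> \<in> test_functions \<Omega>" and \<psi>: "\<psi> \<in> test_functions \<Omega>"
  shows "(\<lambda>x. \<phi> x * \<psi> x) \<in> test_functions \<Omega>"
proof -
  have "Ck_on k UNIV (\<lambda>x. \<phi> x * \<psi> x)" for k
    using \<phi> \<psi> unfolding test_functions_def smooth_on_def by (blast intro: Ck_on_mult)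
  moreover obtain K where K: "compact K" "K \<subseteq> \<Omega>" "\<And>x. x \<notin> K \<Longrightarrow> \<phi> x = 0"
    using test_function_support[OF \<phi>] by blast
  ultimately show ?thesis
    unfolding test_functions_def smooth_on_def
    by (intro CollectI conjI allI exI[of _ K]) auto
qed

lemma test_function_bounded:
  assumes "\<phi> \<in> test_functions \<Omega>"
  obtains B where "B > 0" "\<And>x. \<bar>\<phi> x\<bar> \<le> B"
proof -
  obtain K where K: "compact K" "K \<subseteq> \<Omega>" "\<And>x. x \<notin> K \<Longrightarrow> \<phi> x = 0"
    using test_function_support[OF assms] by blast
  have "bounded (\<phi> ` K)"
    by (intro compact_imp_bounded compact_continuous_image K
        continuous_on_subset[OF test_function_continuous[OF assms]]) auto
  then obtain B where B: "B > 0" "\<And>x. x \<in> K \<Longrightarrow> \<bar>\<phi> x\<bar> \<le> B"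
    unfolding bounded_pos by auto
  have "\<bar>\<phi> x\<bar> \<le> B" for x using B K(3)[of x] by (cases "x \<in> K") auto
  then show ?thesis using that B(1) by blast
qed

lemma test_function_borel: "\<phi> \<in> test_functions \<Omega> \<Longrightarrow> \<phi> \<in> borel_measurable borel"
  by (intro borel_measurable_continuous_onI test_function_continuous)

lemma test_function_integrable:
  assumes "\<phi> \<in> test_functions \<Omega>"
  shows "integrable lborel \<phi>"
proof -
  obtain K where K: "compact K" "K \<subseteq> \<Omega>" "\<And>x. x \<notin> K \<Longrightarrow> \<phi> x = 0"
    using test_function_support[OF assms] by blast
  have "integrable lborel (\<lambda>x. indicator K x *\<^sub>R \<phi> x)"
    by (intro borel_integrable_compact K continuous_on_subset[OF test_function_continuous[OF assms]]) auto
  moreover have "(\<lambda>x. indicator K x *\<^sub>R \<phi> x) = \<phi>" using K(3) by (force simp: indicator_def)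
  ultimately show ?thesis by simp
qed

lemma test_function_integral_eq:
  assumes \<Omega>: "open \<Omega>" and \<phi>: "\<phi> \<in> test_functions \<Omega>"
  shows "(LINT x|lebesgue_on \<Omega>. \<phi> x) = (LINT x|lborel. \<phi> x)"
proof -
  obtain K where K: "compact K" "K \<subseteq> \<Omega>" "\<And>x. x \<notin> K \<Longrightarrow> \<phi> x = 0"
    using test_function_support[OF \<phi>] by blast
  have "(LINT x|lebesgue_on \<Omega>. \<phi> x) = (LINT x|lebesgue. indicator \<Omega> x *\<^sub>R \<phi> x)"
    using \<Omega> by (intro integral_restrict_space) auto
  also have "(\<lambda>x. indicator \<Omega> x *\<^sub>R \<phi> x) = \<phi>" using K by (force simp: indicator_def)
  finally show ?thesis using test_function_borel[OF \<phi>] by (simp add: integral_completion)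
qed

lemma integral_translation:
  fixes f :: "'a::euclidean_space \<Rightarrow> real"
  assumes [measurable]: "f \<in> borel_measurable borel"
  shows "(LINT x|lborel. f (c + x)) = (LINT x|lborel. f x)"
proof -
  have "(LINT x|lborel. f x) = (LINT x|distr lborel borel ((+) c). f x)"
    by (simp add: lborel_distr_plus)
  also have "\<dots> = (LINT x|lborel. f (c + x))" by (subst integral_distr) auto
  finally show ?thesis by simp
qed

text \<open>The integrals of the difference quotients of \<open>\<phi>\<close> vanish by translation invariance, and the
difference quotients converge boundedly and with common bounded support to the partial derivative.\<close>

lemma integral_partial_eq_0:
  fixes \<phi> :: "'a::euclidean_space \<Rightarrow> real"
  assumes \<phi>: "\<phi> \<in> test_functions \<Omega>" and i: "i \<in> Basis"
  shows "(LINT x|lborel. frechet_derivative \<phi> (at x) i) = 0"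
proof -
  define D where "D x = frechet_derivative \<phi> (at x) i" for x
  have D: "D \<in> test_functions \<Omega>" unfolding D_def by (rule test_function_partial[OF \<phi> i])
  obtain B where B: "B > 0" "\<And>x. \<bar>D x\<bar> \<le> B" using test_function_bounded[OF D] by blast
  obtain K where K: "compact K" "K \<subseteq> \<Omega>" "\<And>x. x \<notin> K \<Longrightarrow> \<phi> x = 0"
    using test_function_support[OF \<phi>] by blast
  obtain \<rho> where \<rho>: "\<And>x. x \<in> K \<Longrightarrow> norm x \<le> \<rho>"
    using compact_imp_bounded[OF K(1)] unfolding bounded_iff by blast
  define h where "h n = inverse (real (Suc n))" for n
  have h: "0 < h n" "h n \<le> 1" for n unfolding h_def by (auto simp: inverse_le_1_iff)
  have h_lim: "filterlim h (at 0) sequentially"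
    unfolding filterlim_at using LIMSEQ_inverse_real_of_nat h(1) unfolding h_def[abs_def]
    by (auto simp: eventually_sequentially)
  have line: "((\<lambda>t. \<phi> (x + t *\<^sub>R i)) has_real_derivative D (x + t *\<^sub>R i)) (at t)" for x t
  proof -
    have "((\<lambda>t. \<phi> (x + t *\<^sub>R i)) has_derivative (\<lambda>s. frechet_derivative \<phi> (at (x + t *\<^sub>R i)) (s *\<^sub>R i))) (at t)"
      by (rule has_derivative_compose[OF _ test_function_has_derivative[OF \<phi>]])
        (auto intro!: derivative_eq_intros)
    moreover have "frechet_derivative \<phi> (at (x + t *\<^sub>R i)) (s *\<^sub>R i) = D (x + t *\<^sub>R i) * s" for s
      using linear_scale[OF has_derivative_linear[OF test_function_has_derivative[OF \<phi>]]]
      unfolding D_def by simp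
    ultimately show ?thesis unfolding has_field_derivative_def by simp
  qed
  define q where "q n x = (\<phi> (h n *\<^sub>R i + x) - \<phi> x) / h n" for n x
  note meas[measurable] = test_function_borel[OF \<phi>] test_function_borel[OF D]
  have trans_int: "integrable lborel (\<lambda>x. \<phi> (c + x))" for c
  proof -
    have "integrable (distr lborel borel ((+) c)) \<phi>"
      using test_function_integrable[OF \<phi>] by (simp add: lborel_distr_plus)
    then show ?thesis by (subst (asm) integrable_distr_eq) auto
  qed
  have "(LINT x|lborel. q n x) = 0" for n
    using trans_int test_function_integrable[OF \<phi>] integral_translation[OF meas(1)]
    unfolding q_def by simp
  moreover have "(\<lambda>n. LINT x|lborel. q n x) \<longlonglongrightarrow> (LINT x|lborel. D x)"
  proof (rule integral_dominated_convergence[where w = "\<lambda>x. indicator (cball 0 (\<rho> + 1)) x *\<^sub>R B"])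
    show "integrable lborel (\<lambda>x::'a. indicator (cball 0 (\<rho> + 1)) x *\<^sub>R B)"
      by (intro borel_integrable_compact) auto
    show "AE x in lborel. (\<lambda>n. q n x) \<longlonglongrightarrow> D x"
    proof (rule AE_I2)
      fix x
      have "((\<lambda>t. (\<phi> (x + t *\<^sub>R i) - \<phi> x) / t) \<longlongrightarrow> D x) (at 0)"
        using line[of x 0] unfolding has_field_derivative_iff by simp
      from filterlim_compose[OF this h_lim] show "(\<lambda>n. q n x) \<longlonglongrightarrow> D x"
        unfolding q_def by (simp add: add.commute)
    qed
    show "AE x in lborel. norm (q n x) \<le> indicator (cball 0 (\<rho> + 1)) x *\<^sub>R B" for n
    proof (rule AE_I2)
      fix x
      show "norm (q n x) \<le> indicator (cball 0 (\<rho> + 1)) x *\<^sub>R B"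
      proof (cases "x \<in> cball 0 (\<rho> + 1)")
        case True
        have "norm (\<phi> (x + h n *\<^sub>R i) - \<phi> (x + 0 *\<^sub>R i)) \<le> B * norm (h n - 0)"
          by (rule field_differentiable_bound[where S = UNIV and f' = "\<lambda>t. D (x + t *\<^sub>R i)"])
            (use line B in auto)
        then show ?thesis using True h[of n]
          unfolding q_def by (simp add: add.commute divide_le_eq abs_divide)
      next
        case False
        then have "x \<notin> K" "h n *\<^sub>R i + x \<notin> K"
          using \<rho>[of x] \<rho>[of "h n *\<^sub>R i + x"] norm_triangle_ineq4[of "h n *\<^sub>R i + x" "h n *\<^sub>R i"] h[of n] i
          by auto
        then show ?thesis using K(3) B(1) unfolding q_def by simp
      qed
    qed
    show "q n \<in> borel_measurable lborel" for n unfolding q_def by measurable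
  qed simp
  ultimately show ?thesis by (simp add: LIMSEQ_const_iff D_def)
qed

definition grad :: "('a::euclidean_space \<Rightarrow> real) \<Rightarrow> 'a \<Rightarrow> 'a" where
  "grad \<phi> x = (\<Sum>i\<in>Basis. frechet_derivative \<phi> (at x) i *\<^sub>R i)"

lemma continuous_on_grad:
  assumes "\<phi> \<in> test_functions \<Omega>"
  shows "continuous_on UNIV (grad \<phi>)"
  unfolding grad_def[abs_def]
  by (intro continuous_intros test_function_continuous[OF test_function_partial[OF assms]])

lemma continuous_imp_locally_integrable:
  fixes f :: "'a::euclidean_space \<Rightarrow> 'b::euclidean_space"
  assumes "continuous_on UNIV f"
  shows "f locally_integrable_on \<Omega>"
  unfolding locally_integrable_on_def
proof (intro allI impI)
  fix K assume "compact K \<and> K \<subseteq> \<Omega>"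
  then have "integrable lborel (\<lambda>x. indicator K x *\<^sub>R f x)"
    by (intro borel_integrable_compact continuous_on_subset[OF assms]) auto
  then have "integrable lebesgue (\<lambda>x. indicator K x *\<^sub>R f x)"
    using integrable_completion borel_measurable_integrable by blast
  then show "f absolutely_integrable_on K" by (simp add: set_integrable_def)
qed

text \<open>Integration by parts: \<open>\<integral> \<partial>\<^sub>i (\<phi> \<psi>) = 0\<close> and the product rule.\<close>

lemma has_weak_gradient_test_function:
  assumes \<Omega>: "open \<Omega>" and \<phi>: "\<phi> \<in> test_functions \<Omega>"
  shows "has_weak_gradient \<Omega> \<phi> (grad \<phi>)"
  unfolding has_weak_gradient_def
proof (intro conjI ballI)
  show "\<phi> locally_integrable_on \<Omega>" "grad \<phi> locally_integrable_on \<Omega>"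
    using \<phi> by (auto intro: continuous_imp_locally_integrable test_function_continuous continuous_on_grad)
  fix \<psi> and i :: 'a assume \<psi>: "\<psi> \<in> test_functions \<Omega>" and i: "i \<in> Basis"
  have gi: "grad \<phi> x \<bullet> i = frechet_derivative \<phi> (at x) i" for x
    using i unfolding grad_def by (simp add: inner_sum_left inner_Basis if_distrib sum.If_cases cong: if_cong)
  have t: "(\<lambda>x. \<phi> x * frechet_derivative \<psi> (at x) i) \<in> test_functions \<Omega>"
    "(\<lambda>x. frechet_derivative \<phi> (at x) i * \<psi> x) \<in> test_functions \<Omega>"
    using \<phi> \<psi> i by (auto intro: test_function_mult test_function_partial)
  have "frechet_derivative (\<lambda>x. \<phi> x * \<psi> x) (at x) i
      = \<phi> x * frechet_derivative \<psi> (at x) i + frechet_derivative \<phi> (at x) i * \<psi> x" for x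
    using frechet_derivative_eqI[OF has_derivative_mult[OF test_function_has_derivative[OF \<phi>] test_function_has_derivative[OF \<psi>]]]
    by simp
  then have "0 = (LINT x|lborel. \<phi> x * frechet_derivative \<psi> (at x) i + frechet_derivative \<phi> (at x) i * \<psi> x)"
    using integral_partial_eq_0[OF test_function_mult[OF \<phi> \<psi>] i] by simp
  also have "\<dots> = (LINT x|lborel. \<phi> x * frechet_derivative \<psi> (at x) i) + (LINT x|lborel. frechet_derivative \<phi> (at x) i * \<psi> x)"
    by (intro Bochner_Integration.integral_add test_function_integrable[OF t(1)] test_function_integrable[OF t(2)])
  finally show "(LINT x|lebesgue_on \<Omega>. \<phi> x * frechet_derivative \<psi> (at x) i)
      = - (LINT x|lebesgue_on \<Omega>. (grad \<phi> x \<bullet> i) * \<psi> x)"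
    using test_function_integral_eq[OF \<Omega> t(1)] test_function_integral_eq[OF \<Omega> t(2)] unfolding gi by simp
qed

lemma integrable_locally_integrable_mult_test_function:
  fixes h \<phi> :: "'a::euclidean_space \<Rightarrow> real"
  assumes \<Omega>: "open \<Omega>" and h: "h locally_integrable_on \<Omega>" and \<phi>: "\<phi> \<in> test_functions \<Omega>"
  shows "integrable (lebesgue_on \<Omega>) (\<lambda>x. h x * \<phi> x)"
proof -
  obtain K where K: "compact K" "K \<subseteq> \<Omega>" "\<And>x. x \<notin> K \<Longrightarrow> \<phi> x = 0"
    using test_function_support[OF \<phi>] by blast
  obtain B where B: "B > 0" "\<And>x. \<bar>\<phi> x\<bar> \<le> B" using test_function_bounded[OF \<phi>] by blast
  have H: "integrable lebesgue (\<lambda>x. indicat_real K x * h x)"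
    using h K unfolding locally_integrable_on_def by (simp add: set_integrable_def)
  have \<phi>': "\<phi> \<in> borel_measurable lebesgue"
    using test_function_borel[OF \<phi>] by (intro measurable_completion) simp
  have "integrable lebesgue (\<lambda>x. (indicat_real K x * h x) * \<phi> x)"
  proof (rule Bochner_Integration.integrable_bound[where f = "\<lambda>x. B * (indicat_real K x * h x)"])
    show "(\<lambda>x. (indicat_real K x * h x) * \<phi> x) \<in> borel_measurable lebesgue"
      using borel_measurable_times[OF borel_measurable_integrable[OF H] \<phi>'] .
    show "AE x in lebesgue. norm (indicat_real K x * h x * \<phi> x) \<le> norm (B * (indicat_real K x * h x))"
    proof (rule AE_I2)
      fix x
      have "\<bar>indicat_real K x * h x\<bar> * \<bar>\<phi> x\<bar> \<le> \<bar>indicat_real K x * h x\<bar> * B"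
        by (rule mult_left_mono[OF B(2)]) simp
      then show "norm (indicat_real K x * h x * \<phi> x) \<le> norm (B * (indicat_real K x * h x))"
        using B(1) unfolding real_norm_def abs_mult by (simp only: abs_of_pos mult_ac)
    qed
  qed (use H in simp)
  moreover have "(indicat_real K x * h x) * \<phi> x = indicator \<Omega> x *\<^sub>R (h x * \<phi> x)" for x
    using K by (auto simp: indicator_def)
  ultimately show ?thesis using \<Omega> by (simp add: integrable_restrict_space)
qed

lemma locally_integrable_inner:
  fixes g :: "'a::euclidean_space \<Rightarrow> 'b::euclidean_space"
  assumes "g locally_integrable_on \<Omega>"
  shows "(\<lambda>x. g x \<bullet> i) locally_integrable_on \<Omega>"
  unfolding locally_integrable_on_def
proof (intro allI impI)
  fix K assume "compact K \<and> K \<subseteq> \<Omega>"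
  then have "integrable lebesgue (\<lambda>x. (indicator K x *\<^sub>R g x) \<bullet> i)"
    using assms unfolding locally_integrable_on_def set_integrable_def by (intro integrable_inner_left) auto
  then show "(\<lambda>x. g x \<bullet> i) absolutely_integrable_on K" by (simp add: set_integrable_def)
qed

lemma locally_integrable_diff:
  fixes f g :: "'a::euclidean_space \<Rightarrow> 'b::euclidean_space"
  assumes "f locally_integrable_on \<Omega>" "g locally_integrable_on \<Omega>"
  shows "(\<lambda>x. f x - g x) locally_integrable_on \<Omega>"
  using assms unfolding locally_integrable_on_def by (blast intro: set_integral_diff(1))

lemma has_weak_gradient_diff:
  assumes \<Omega>: "open \<Omega>" and u: "has_weak_gradient \<Omega> u f" and v: "has_weak_gradient \<Omega> v g"
  shows "has_weak_gradient \<Omega> (\<lambda>x. u x - v x) (\<lambda>x. f x - g x)"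
  unfolding has_weak_gradient_def
proof (intro conjI ballI)
  have li: "u locally_integrable_on \<Omega>" "v locally_integrable_on \<Omega>" "f locally_integrable_on \<Omega>" "g locally_integrable_on \<Omega>"
    using u v unfolding has_weak_gradient_def by auto
  then show "(\<lambda>x. u x - v x) locally_integrable_on \<Omega>" "(\<lambda>x. f x - g x) locally_integrable_on \<Omega>"
    by (auto intro: locally_integrable_diff)
  fix \<phi> and i :: 'a assume \<phi>: "\<phi> \<in> test_functions \<Omega>" and i: "i \<in> Basis"
  note int = integrable_locally_integrable_mult_test_function[OF \<Omega>]
  have "(LINT x|lebesgue_on \<Omega>. (u x - v x) * frechet_derivative \<phi> (at x) i)
      = (LINT x|lebesgue_on \<Omega>. u x * frechet_derivative \<phi> (at x) i) - (LINT x|lebesgue_on \<Omega>. v x * frechet_derivative \<phi> (at x) i)"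
    unfolding left_diff_distrib
    by (intro Bochner_Integration.integral_diff int li test_function_partial[OF \<phi> i])
  moreover have "(LINT x|lebesgue_on \<Omega>. ((f x - g x) \<bullet> i) * \<phi> x)
      = (LINT x|lebesgue_on \<Omega>. (f x \<bullet> i) * \<phi> x) - (LINT x|lebesgue_on \<Omega>. (g x \<bullet> i) * \<phi> x)"
    unfolding inner_diff_left left_diff_distrib
    by (intro Bochner_Integration.integral_diff int locally_integrable_inner li \<phi>)
  ultimately show "(LINT x|lebesgue_on \<Omega>. (u x - v x) * frechet_derivative \<phi> (at x) i)
      = - (LINT x|lebesgue_on \<Omega>. ((f x - g x) \<bullet> i) * \<phi> x)"
    using u v \<phi> i unfolding has_weak_gradient_def by simp
qed

lemma has_weak_gradient_unique:
  assumes \<Omega>: "open \<Omega>" and f: "has_weak_gradient \<Omega> u f" and g: "has_weak_gradient \<Omega> u g"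
  shows "AE x in lebesgue_on \<Omega>. f x = g x"
proof -
  have d: "has_weak_gradient \<Omega> (\<lambda>x. 0) (\<lambda>x. f x - g x)"
    using has_weak_gradient_diff[OF \<Omega> f g] by simp
  have "AE x in lebesgue_on \<Omega>. (f x - g x) \<bullet> i = 0" if "i \<in> Basis" for i
  proof (rule AE_eq_0_if_test_functions[OF \<Omega>])
    show "(\<lambda>x. (f x - g x) \<bullet> i) locally_integrable_on \<Omega>"
      using d unfolding has_weak_gradient_def by (intro locally_integrable_inner) auto
  qed (use d that in \<open>auto simp: has_weak_gradient_def\<close>)
  then have "AE x in lebesgue_on \<Omega>. \<forall>i\<in>Basis. (f x - g x) \<bullet> i = 0"
    by (intro AE_finite_allI) auto
  then show ?thesis
    by eventually_elim (metis euclidean_eqI inner_zero_left right_minus_eq)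
qed

lemma has_weak_gradient_weak_gradient:
  "has_weak_gradient \<Omega> u g \<Longrightarrow> has_weak_gradient \<Omega> u (weak_gradient \<Omega> u)"
  unfolding weak_gradient_def by (rule someI[where P = "has_weak_gradient \<Omega> u"])

section \<open>Averaging along rays\<close>

lemma frechet_derivative_eq_grad:
  assumes "\<phi> \<in> test_functions \<Omega>"
  shows "frechet_derivative \<phi> (at x) z = grad \<phi> x \<bullet> z"
proof -
  have lin: "linear (frechet_derivative \<phi> (at x))"
    by (rule has_derivative_linear[OF test_function_has_derivative[OF assms]])
  have "frechet_derivative \<phi> (at x) (\<Sum>i\<in>Basis. (z \<bullet> i) *\<^sub>R i) = grad \<phi> x \<bullet> z"
    unfolding linear_sum[OF lin] linear_scale[OF lin] grad_def inner_sum_left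
    by (intro sum.cong) (auto simp: inner_commute)
  then show ?thesis by (simp add: euclidean_representation)
qed

text \<open>The domain has diameter at most \<open>2 * \<rho>\<close>, so the ray from a point of \<open>\<Omega>\<close> in a direction of length at
least \<open>1\<close> has left the support of \<open>\<phi>\<close> at time \<open>R\<close>.\<close>

lemma test_function_le_ray_integral:
  fixes \<phi> :: "'a::euclidean_space \<Rightarrow> real"
  assumes \<phi>: "\<phi> \<in> test_functions \<Omega>" and \<Omega>: "\<Omega> \<subseteq> cball 0 \<rho>" and R: "R > 2 * \<rho>" "R > 0" and z: "norm z \<ge> 1"
  shows "ennreal \<bar>\<phi> x\<bar> \<le> ennreal (norm z) *
    (\<integral>\<^sup>+t. indicator {0<..R} t * ennreal (norm (grad \<phi> (x + t *\<^sub>R z))) \<partial>lborel)"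
proof (cases "x \<in> \<Omega>")
  case False
  obtain K where "compact K" "K \<subseteq> \<Omega>" "\<And>x. x \<notin> K \<Longrightarrow> \<phi> x = 0"
    using test_function_support[OF \<phi>] by blast
  then have "\<phi> x = 0" using False by blast
  then show ?thesis by simp
next
  case True
  obtain K where K: "compact K" "K \<subseteq> \<Omega>" "\<And>x. x \<notin> K \<Longrightarrow> \<phi> x = 0"
    using test_function_support[OF \<phi>] by blast
  have "norm (x + R *\<^sub>R z) > \<rho>"
  proof -
    have "R * 1 \<le> R * norm z" using z R by (intro mult_left_mono) auto
    moreover have "norm (R *\<^sub>R z) \<le> norm (x + R *\<^sub>R z) + norm x"
      using norm_triangle_ineq4[of "x + R *\<^sub>R z" x] by simp
    moreover have "norm (R *\<^sub>R z) = R * norm z" using R by simp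
    moreover have "norm x \<le> \<rho>" using True \<Omega> by auto
    ultimately show ?thesis using R by linarith
  qed
  then have end0: "\<phi> (x + R *\<^sub>R z) = 0" using K \<Omega> by fastforce
  have cont: "continuous_on {0..R} (\<lambda>t. grad \<phi> (x + t *\<^sub>R z))"
    by (rule continuous_on_compose2[OF continuous_on_grad[OF \<phi>]]) (auto intro!: continuous_intros)
  have "((\<lambda>t. grad \<phi> (x + t *\<^sub>R z) \<bullet> z) has_integral (\<phi> (x + R *\<^sub>R z) - \<phi> (x + 0 *\<^sub>R z))) {0..R}"
  proof (rule fundamental_theorem_of_calculus)
    fix t assume "t \<in> {0..R}"
    have "((\<lambda>t. \<phi> (x + t *\<^sub>R z)) has_derivative (\<lambda>s. frechet_derivative \<phi> (at (x + t *\<^sub>R z)) (s *\<^sub>R z))) (at t within {0..R})"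
      by (rule has_derivative_compose[OF _ test_function_has_derivative[OF \<phi>]])
        (auto intro!: derivative_eq_intros)
    then show "((\<lambda>t. \<phi> (x + t *\<^sub>R z)) has_vector_derivative grad \<phi> (x + t *\<^sub>R z) \<bullet> z) (at t within {0..R})"
      unfolding has_vector_derivative_def frechet_derivative_eq_grad[OF \<phi>] by simp
  qed (use R in auto)
  then have I: "integral {0..R} (\<lambda>t. grad \<phi> (x + t *\<^sub>R z) \<bullet> z) = - \<phi> x"
    using end0 by (auto dest: integral_unique)
  define g where "g t = norm (grad \<phi> (x + t *\<^sub>R z))" for t
  have g: "continuous_on {0..R} g" unfolding g_def by (intro continuous_intros cont)
  have "\<bar>\<phi> x\<bar> = norm (integral {0..R} (\<lambda>t. grad \<phi> (x + t *\<^sub>R z) \<bullet> z))" using I by simp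
  also have "\<dots> \<le> integral {0..R} (\<lambda>t. norm z * g t)"
    unfolding g_def
    by (intro integral_norm_bound_integral integrable_continuous_real continuous_intros cont)
      (simp add: Cauchy_Schwarz_ineq2 mult.commute[of "norm z"])
  also have "\<dots> = norm z * integral {0..R} g" by simp
  finally have le: "\<bar>\<phi> x\<bar> \<le> norm z * integral {0..R} g" .
  have int: "integrable lborel (\<lambda>t. indicator {0..R} t *\<^sub>R g t)"
    by (intro borel_integrable_compact g) auto
  have "integral {0..R} g = (LINT t|lborel. indicator {0..R} t *\<^sub>R g t)"
    using set_borel_integral_eq_integral(2)[of "{0..R}" g] int
    unfolding set_integrable_def set_lebesgue_integral_def by simp
  then have "ennreal (integral {0..R} g) = (\<integral>\<^sup>+t. ennreal (indicator {0..R} t *\<^sub>R g t) \<partial>lborel)"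
    using nn_integral_eq_integral[OF int] by (simp add: g_def)
  also have "\<dots> = (\<integral>\<^sup>+t. indicator {0<..R} t * ennreal (g t) \<partial>lborel)"
    by (intro nn_integral_cong_AE eventually_mono[OF AE_lborel_singleton[of 0]])
      (auto simp: indicator_def)
  finally have "ennreal (norm z) * (\<integral>\<^sup>+t. indicator {0<..R} t * ennreal (g t) \<partial>lborel)
      = ennreal (norm z * integral {0..R} g)"
    by (simp add: ennreal_mult')
  then show ?thesis using le unfolding g_def by (simp add: ennreal_leI)
qed

text \<open>A set of directions of measure \<open>1\<close> that is bounded and stays away from the origin.\<close>

definition ray_box :: "'a::euclidean_space set" where
  "ray_box = cbox One (2 *\<^sub>R One)"

lemma emeasure_ray_box: "emeasure lborel (ray_box :: 'a::euclidean_space set) = 1"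
  unfolding ray_box_def by (subst emeasure_lborel_cbox) (auto simp: inner_diff_left)

lemma ray_box_norm:
  assumes "z \<in> (ray_box :: 'a::euclidean_space set)"
  shows "1 \<le> norm z" "norm z \<le> 2 * real DIM('a)"
proof -
  have z: "1 \<le> z \<bullet> i" "z \<bullet> i \<le> 2" if "i \<in> Basis" for i
    using assms that unfolding ray_box_def mem_box by auto
  obtain i where "i \<in> (Basis :: 'a set)" using nonempty_Basis by blast
  then show "1 \<le> norm z" using z(1) Basis_le_norm[of i z] by fastforce
  have "norm z \<le> (\<Sum>i\<in>Basis. \<bar>z \<bullet> i\<bar>)" by (rule norm_le_l1)
  also have "\<dots> \<le> (\<Sum>i\<in>(Basis::'a set). 2)" using z by (intro sum_mono) force
  finally show "norm z \<le> 2 * real DIM('a)" by simp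
qed

definition ray_average :: "(real \<Rightarrow> ennreal) \<Rightarrow> ('a::euclidean_space \<Rightarrow> ennreal) \<Rightarrow> 'a \<Rightarrow> ennreal" where
  "ray_average w g x =
     (\<integral>\<^sup>+z. indicator ray_box z * (\<integral>\<^sup>+t. w t * g (x + t *\<^sub>R z) \<partial>lborel) \<partial>lborel)"

lemma ray_box_sets[measurable]: "ray_box \<in> sets borel"
  unfolding ray_box_def by simp

lemma ray_average_swap:
  assumes [measurable]: "w \<in> borel_measurable borel" "g \<in> borel_measurable borel"
  shows "ray_average w g x = (\<integral>\<^sup>+t. w t * (\<integral>\<^sup>+z. indicator ray_box z * g (x + t *\<^sub>R z) \<partial>lborel) \<partial>lborel)"
proof -
  have "ray_average w g x = (\<integral>\<^sup>+z. (\<integral>\<^sup>+t. indicator ray_box z * (w t * g (x + t *\<^sub>R z)) \<partial>lborel) \<partial>lborel)"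
    unfolding ray_average_def by (intro nn_integral_cong nn_integral_cmult[symmetric]) measurable
  also have "\<dots> = (\<integral>\<^sup>+t. (\<integral>\<^sup>+z. indicator ray_box z * (w t * g (x + t *\<^sub>R z)) \<partial>lborel) \<partial>lborel)"
    by (rule lborel_pair.Fubini') measurable
  also have "\<dots> = (\<integral>\<^sup>+t. w t * (\<integral>\<^sup>+z. indicator ray_box z * g (x + t *\<^sub>R z) \<partial>lborel) \<partial>lborel)"
  proof (intro nn_integral_cong)
    fix t
    have "(\<integral>\<^sup>+z. indicator ray_box z * (w t * g (x + t *\<^sub>R z)) \<partial>lborel)
        = (\<integral>\<^sup>+z. w t * (indicator ray_box z * g (x + t *\<^sub>R z)) \<partial>lborel)"
      by (simp add: mult_ac)
    also have "\<dots> = w t * (\<integral>\<^sup>+z. indicator ray_box z * g (x + t *\<^sub>R z) \<partial>lborel)"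
      by (rule nn_integral_cmult) measurable
    finally show "(\<integral>\<^sup>+z. indicator ray_box z * (w t * g (x + t *\<^sub>R z)) \<partial>lborel)
        = w t * (\<integral>\<^sup>+z. indicator ray_box z * g (x + t *\<^sub>R z) \<partial>lborel)" .
  qed
  finally show ?thesis .
qed

lemma nn_integral_dilation:
  fixes g :: "'a::euclidean_space \<Rightarrow> ennreal"
  assumes [measurable]: "g \<in> borel_measurable borel" and t: "t > 0"
  shows "(\<integral>\<^sup>+z. g (x + t *\<^sub>R z) \<partial>lborel) = ennreal (t powr - real DIM('a)) * (\<integral>\<^sup>+z. g z \<partial>lborel)"
proof -
  have "(\<integral>\<^sup>+z. g z \<partial>lborel) = ennreal (t powr real DIM('a)) * (\<integral>\<^sup>+z. g (x + t *\<^sub>R z) \<partial>lborel)"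
    using t by (subst lborel_affine[of t x])
      (auto simp: nn_integral_density nn_integral_distr nn_integral_cmult powr_realpow)
  then have "ennreal (t powr - real DIM('a)) * (\<integral>\<^sup>+z. g z \<partial>lborel)
      = (ennreal (t powr - real DIM('a)) * ennreal (t powr real DIM('a))) * (\<integral>\<^sup>+z. g (x + t *\<^sub>R z) \<partial>lborel)"
    by (simp add: mult.assoc)
  also have "ennreal (t powr - real DIM('a)) * ennreal (t powr real DIM('a)) = 1"
    using t by (simp add: ennreal_mult'[symmetric] powr_add[symmetric])
  finally show ?thesis by simp
qed

lemma nn_integral_translation:
  fixes g :: "'a::euclidean_space \<Rightarrow> ennreal"
  assumes [measurable]: "g \<in> borel_measurable borel"
  shows "(\<integral>\<^sup>+x. g (x + c) \<partial>lborel) = (\<integral>\<^sup>+x. g x \<partial>lborel)"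
  using nn_integral_dilation[of g 1 c] assms by (simp add: add.commute)

definition power_weight :: "real \<Rightarrow> real \<Rightarrow> real \<Rightarrow> ennreal" where
  "power_weight R a t = indicator {0<..R} t * ennreal (t powr a)"

lemma power_weight_borel[measurable]: "power_weight R a \<in> borel_measurable borel"
  unfolding power_weight_def[abs_def] by measurable

lemma nn_integral_power_weight_finite:
  assumes "a > -1" "R \<ge> 0"
  shows "(\<integral>\<^sup>+t. power_weight R a t \<partial>lborel) < \<infinity>"
proof -
  define f where "f t = (if t \<in> {0..R} then t powr a else 0)" for t :: real
  have "(f has_integral (R powr (a+1) / (a+1))) UNIV"
    unfolding f_def has_integral_restrict_UNIV by (rule has_integral_powr_from_0[OF assms])
  moreover have "f \<in> borel_measurable borel" unfolding f_def[abs_def] by measurable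
  ultimately have "integral\<^sup>N lborel f = ennreal (R powr (a+1) / (a+1))"
    by (rule nn_integral_has_integral_lborel[rotated 2]) (simp add: f_def)
  moreover have "(\<integral>\<^sup>+t. power_weight R a t \<partial>lborel) \<le> integral\<^sup>N lborel f"
    by (intro nn_integral_mono) (auto simp: power_weight_def f_def indicator_def)
  ultimately show ?thesis by (simp add: le_less_trans)
qed

text \<open>Extending the integral over directions to the whole space turns it into \<open>t powr - N\<close> times the
integral of \<open>g\<close>. The singularity at \<open>t = 0\<close> is paid for by the weight.\<close>

lemma ray_average_bounded:
  fixes g :: "'a::euclidean_space \<Rightarrow> ennreal"
  assumes [measurable]: "g \<in> borel_measurable borel"
  shows "ray_average (power_weight R b) g x
     \<le> (\<integral>\<^sup>+t. power_weight R (b - DIM('a)) t \<partial>lborel) * (\<integral>\<^sup>+z. g z \<partial>lborel)"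
proof -
  have "ray_average (power_weight R b) g x
      = (\<integral>\<^sup>+t. power_weight R b t * (\<integral>\<^sup>+z. indicator ray_box z * g (x + t *\<^sub>R z) \<partial>lborel) \<partial>lborel)"
    by (rule ray_average_swap) measurable
  also have "\<dots> \<le> (\<integral>\<^sup>+t. power_weight R (b - DIM('a)) t * (\<integral>\<^sup>+z. g z \<partial>lborel) \<partial>lborel)"
  proof (rule nn_integral_mono)
    fix t :: real
    show "power_weight R b t * (\<integral>\<^sup>+z. indicator ray_box z * g (x + t *\<^sub>R z) \<partial>lborel)
        \<le> power_weight R (b - DIM('a)) t * (\<integral>\<^sup>+z. g z \<partial>lborel)"
    proof (cases "t > 0")
      case True
      have "(\<integral>\<^sup>+z. indicator ray_box z * g (x + t *\<^sub>R z) \<partial>lborel) \<le> (\<integral>\<^sup>+z. g (x + t *\<^sub>R z) \<partial>lborel)"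
        by (intro nn_integral_mono) (auto simp: indicator_def)
      also have "\<dots> = ennreal (t powr - real DIM('a)) * (\<integral>\<^sup>+z. g z \<partial>lborel)"
        by (rule nn_integral_dilation) (use True in auto)
      finally have "power_weight R b t * (\<integral>\<^sup>+z. indicator ray_box z * g (x + t *\<^sub>R z) \<partial>lborel)
        \<le> power_weight R b t * (ennreal (t powr - real DIM('a)) * (\<integral>\<^sup>+z. g z \<partial>lborel))"
        by (rule mult_left_mono) simp
      also have "\<dots> = power_weight R (b - DIM('a)) t * (\<integral>\<^sup>+z. g z \<partial>lborel)"
        unfolding power_weight_def
        by (simp add: mult.assoc[symmetric] ennreal_mult'[symmetric] powr_add[symmetric])
          (simp add: mult.assoc ennreal_mult'[symmetric] powr_add[symmetric])
      finally show ?thesis .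
    qed (simp add: power_weight_def)
  qed
  also have "\<dots> = (\<integral>\<^sup>+t. power_weight R (b - DIM('a)) t \<partial>lborel) * (\<integral>\<^sup>+z. g z \<partial>lborel)"
    by (rule nn_integral_multc) measurable
  finally show ?thesis .
qed

text \<open>Translation invariance makes the inner integral independent of \<open>t\<close> and \<open>z\<close>.\<close>

lemma nn_integral_ray_average:
  fixes g :: "'a::euclidean_space \<Rightarrow> ennreal"
  assumes [measurable]: "w \<in> borel_measurable borel" "g \<in> borel_measurable borel"
  shows "(\<integral>\<^sup>+x. ray_average w g x \<partial>lborel) = (\<integral>\<^sup>+t. w t \<partial>lborel) * (\<integral>\<^sup>+x. g x \<partial>lborel)"
proof -
  have inner: "(\<integral>\<^sup>+x. (\<integral>\<^sup>+t. w t * g (x + t *\<^sub>R z) \<partial>lborel) \<partial>lborel)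
      = (\<integral>\<^sup>+t. w t \<partial>lborel) * (\<integral>\<^sup>+x. g x \<partial>lborel)" for z
  proof -
    have "(\<integral>\<^sup>+x. (\<integral>\<^sup>+t. w t * g (x + t *\<^sub>R z) \<partial>lborel) \<partial>lborel)
        = (\<integral>\<^sup>+t. (\<integral>\<^sup>+x. w t * g (x + t *\<^sub>R z) \<partial>lborel) \<partial>lborel)"
      by (rule lborel_pair.Fubini') measurable
    also have "\<dots> = (\<integral>\<^sup>+t. w t * (\<integral>\<^sup>+x. g x \<partial>lborel) \<partial>lborel)"
      by (simp add: nn_integral_cmult nn_integral_translation)
    also have "\<dots> = (\<integral>\<^sup>+t. w t \<partial>lborel) * (\<integral>\<^sup>+x. g x \<partial>lborel)"
      by (rule nn_integral_multc) measurable
    finally show ?thesis .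
  qed
  have "(\<integral>\<^sup>+x. ray_average w g x \<partial>lborel)
      = (\<integral>\<^sup>+z. (\<integral>\<^sup>+x. indicator ray_box z * (\<integral>\<^sup>+t. w t * g (x + t *\<^sub>R z) \<partial>lborel) \<partial>lborel) \<partial>lborel)"
    unfolding ray_average_def by (rule lborel_pair.Fubini') measurable
  also have "\<dots> = (\<integral>\<^sup>+z. indicator (ray_box :: 'a set) z * ((\<integral>\<^sup>+t. w t \<partial>lborel) * (\<integral>\<^sup>+x. g x \<partial>lborel)) \<partial>lborel)"
  proof (intro nn_integral_cong)
    fix z :: 'a
    have "(\<integral>\<^sup>+x. indicator ray_box z * (\<integral>\<^sup>+t. w t * g (x + t *\<^sub>R z) \<partial>lborel) \<partial>lborel)
      = indicator ray_box z * (\<integral>\<^sup>+x. (\<integral>\<^sup>+t. w t * g (x + t *\<^sub>R z) \<partial>lborel) \<partial>lborel)"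
      by (rule nn_integral_cmult) measurable
    then show "(\<integral>\<^sup>+x. indicator ray_box z * (\<integral>\<^sup>+t. w t * g (x + t *\<^sub>R z) \<partial>lborel) \<partial>lborel)
      = indicator ray_box z * ((\<integral>\<^sup>+t. w t \<partial>lborel) * (\<integral>\<^sup>+x. g x \<partial>lborel))" unfolding inner .
  qed
  also have "\<dots> = emeasure lborel (ray_box :: 'a set) * ((\<integral>\<^sup>+t. w t \<partial>lborel) * (\<integral>\<^sup>+x. g x \<partial>lborel))"
    by (subst nn_integral_multc) auto
  finally show ?thesis by (simp add: emeasure_ray_box)
qed

lemma ray_average_const:
  "ray_average w (\<lambda>_. 1) x = (\<integral>\<^sup>+t. w t \<partial>lborel)" for x :: "'a::euclidean_space"
  unfolding ray_average_def using emeasure_ray_box[where 'a = 'a]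
  by (subst nn_integral_multc) auto

lemma test_function_le_ray_average:
  fixes \<phi> :: "'a::euclidean_space \<Rightarrow> real"
  assumes \<phi>: "\<phi> \<in> test_functions \<Omega>" and \<Omega>: "\<Omega> \<subseteq> cball 0 \<rho>" and R: "R > 2 * \<rho>" "R > 0"
  shows "ennreal \<bar>\<phi> x\<bar> \<le> ennreal (2 * real DIM('a)) *
    ray_average (indicator {0<..R}) (\<lambda>y. ennreal (norm (grad \<phi> y))) x"
proof -
  have [measurable]: "grad \<phi> \<in> borel_measurable borel"
    by (intro borel_measurable_continuous_onI continuous_on_grad[OF \<phi>])
  let ?I = "\<lambda>z. \<integral>\<^sup>+t. indicator {0<..R} t * ennreal (norm (grad \<phi> (x + t *\<^sub>R z))) \<partial>lborel"
  have "ennreal \<bar>\<phi> x\<bar> = (\<integral>\<^sup>+z. indicator (ray_box :: 'a set) z * ennreal \<bar>\<phi> x\<bar> \<partial>lborel)"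
    using emeasure_ray_box[where 'a = 'a] by (subst nn_integral_multc) auto
  also have "\<dots> \<le> (\<integral>\<^sup>+z. ennreal (2 * real DIM('a)) * (indicator ray_box z * ?I z) \<partial>lborel)"
  proof (rule nn_integral_mono)
    fix z :: 'a
    show "indicator ray_box z * ennreal \<bar>\<phi> x\<bar> \<le> ennreal (2 * real DIM('a)) * (indicator ray_box z * ?I z)"
    proof (cases "z \<in> ray_box")
      case True
      have "ennreal \<bar>\<phi> x\<bar> \<le> ennreal (norm z) * ?I z"
        by (rule test_function_le_ray_integral[OF \<phi> \<Omega> R ray_box_norm(1)[OF True]])
      also have "\<dots> \<le> ennreal (2 * real DIM('a)) * ?I z"
        using ray_box_norm(2)[OF True] by (intro mult_right_mono ennreal_leI) auto
      finally show ?thesis using True by simp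
    qed simp
  qed
  also have "\<dots> = ennreal (2 * real DIM('a)) * (\<integral>\<^sup>+z. indicator ray_box z * ?I z \<partial>lborel)"
    by (rule nn_integral_cmult) measurable
  finally show ?thesis unfolding ray_average_def .
qed

section \<open>The Sobolev inequality below the critical exponent\<close>

text \<open>Write \<open>f = \<bar>\<nabla>\<phi>\<bar>\<close> and \<open>1 = \<alpha> + \<beta> + \<gamma>\<close> with \<open>\<alpha> = 1/q\<close>, \<open>\<beta> = 1/p - 1/q\<close>, \<open>\<gamma> = 1 - 1/p\<close>. Along the rays,
\<open>f = (f\<^sup>p t\<^sup>-\<^sup>s)\<^sup>\<alpha> (f\<^sup>p t\<^sup>b)\<^sup>\<beta> (t\<^sup>-\<^sup>s)\<^sup>\<gamma>\<close> provided that \<open>b \<beta> = s (1 - \<beta>)\<close>. The ray average of the second factor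
is bounded if \<open>b - N > -1\<close>, that of the third if \<open>s < 1\<close>; both can be achieved exactly when \<open>N \<beta> < 1\<close>, that
is, below the critical exponent. So \<open>\<bar>\<phi> x\<bar>\<^sup>q\<close> is at most a constant times the ray average of
\<open>f\<^sup>p t\<^sup>-\<^sup>s\<close>, whose integral over \<open>x\<close> is a multiple of \<open>\<integral> f\<^sup>p\<close>.\<close>

lemma subcritical_sobolev_normalised:
  fixes \<Omega> :: "'a::euclidean_space set"
  assumes bdd: "bounded \<Omega>" and p: "1 < p" and q: "p < q" and sub: "DIM('a) * (1 / p - 1 / q) < 1"
  shows "\<exists>C>0. \<forall>\<phi>\<in>test_functions \<Omega>.
     (\<integral>\<^sup>+x. ennreal (norm (grad \<phi> x) powr p) \<partial>lborel) \<le> 1 \<longrightarrow>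
     (\<integral>\<^sup>+x. ennreal (\<bar>\<phi> x\<bar> powr q) \<partial>lborel) \<le> ennreal C"
proof -
  define N where "N = real DIM('a)"
  have N: "N \<ge> 1" unfolding N_def using DIM_positive[where 'a = 'a] by (simp add: Suc_leI)
  obtain \<rho> where \<rho>: "\<rho> > 0" "\<Omega> \<subseteq> cball 0 \<rho>"
    using bounded_pos[THEN iffD1, OF bdd] by (auto simp: subset_iff)
  define R where "R = 2 * \<rho> + 1"
  have R: "R > 2 * \<rho>" "R > 0" using \<rho> unfolding R_def by auto
  define \<alpha> \<beta> \<gamma> where "\<alpha> = 1 / q" and "\<beta> = 1 / p - 1 / q" and "\<gamma> = 1 - 1 / p"
  have abc: "\<alpha> > 0" "\<beta> > 0" "\<gamma> > 0" "\<alpha> + \<beta> + \<gamma> = 1"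
    unfolding \<alpha>_def \<beta>_def \<gamma>_def using p q by (auto simp: field_simps)
  have N\<beta>: "N * \<beta> < 1" using sub unfolding N_def \<beta>_def .
  have \<beta>1: "\<beta> < 1" using abc by linarith
  \<comment> \<open>the exponents of the weights: \<open>t powr -s\<close> and \<open>t powr (b - N)\<close> must be integrable at \<open>0\<close>\<close>
  define s0 where "s0 = (N - 1) * \<beta> / (1 - \<beta>)"
  define s where "s = (s0 + 1) / 2"
  define b where "b = s * (1 - \<beta>) / \<beta>"
  have "s0 < 1" unfolding s0_def using N\<beta> \<beta>1 by (simp add: divide_less_eq algebra_simps)
  then have s: "s < 1" "s0 < s" unfolding s_def by auto
  have b\<beta>: "b * \<beta> = s * (1 - \<beta>)" unfolding b_def using abc by simp
  have b: "b - N > -1"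
  proof -
    have "(N - 1) * \<beta> < s * (1 - \<beta>)" using s(2) \<beta>1 unfolding s0_def by (simp add: divide_less_eq)
    then have "N - 1 < b" unfolding b_def using abc by (simp add: less_divide_eq)
    then show ?thesis by simp
  qed
  define Zs where "Zs = enn2real (\<integral>\<^sup>+t. power_weight R (- s) t \<partial>lborel)"
  define Zb where "Zb = enn2real (\<integral>\<^sup>+t. power_weight R (b - N) t \<partial>lborel)"
  have Zs: "(\<integral>\<^sup>+t. power_weight R (- s) t \<partial>lborel) = ennreal Zs" and Zs0: "Zs \<ge> 0"
    unfolding Zs_def using nn_integral_power_weight_finite[of "-s" R] s R by auto
  have Zb: "(\<integral>\<^sup>+t. power_weight R (b - N) t \<partial>lborel) = ennreal Zb" and Zb0: "Zb \<ge> 0"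
    unfolding Zb_def using nn_integral_power_weight_finite[of "b - N" R] b R by auto
  define D where "D = \<beta> * Zb + \<gamma> * Zs"
  have D0: "D \<ge> 0" unfolding D_def using abc Zs0 Zb0 by simp
  define c where "c = 2 * N * (\<alpha> + D)"
  have c0: "c > 0" unfolding c_def using N abc D0 by (intro mult_pos_pos add_pos_nonneg) auto

  have Young: "y \<le> X powr \<alpha> * (\<alpha> / X * (y powr p * t powr - s) + \<beta> * (y powr p * t powr b) + \<gamma> * t powr - s)"
    if t: "t > 0" and X: "X > 0" and y: "y \<ge> 0" for X t y :: real
  proof (cases "y = 0")
    case True
    then show ?thesis using abc t X by simp
  next
    case False
    then have y: "y > 0" using y by simp
    have "(y powr p * t powr - s / X) powr \<alpha> * (y powr p * t powr b) powr \<beta> * (t powr - s) powr \<gamma>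
        = y powr (p * \<alpha> + p * \<beta>) * t powr (- s * \<alpha> + b * \<beta> - s * \<gamma>) / X powr \<alpha>"
      using y t X by (simp add: powr_mult powr_divide powr_powr powr_add powr_diff powr_minus field_simps)
    also have "p * \<alpha> + p * \<beta> = 1" unfolding \<alpha>_def \<beta>_def using p by (simp add: field_simps)
    also have "- s * \<alpha> + b * \<beta> - s * \<gamma> = 0"
    proof -
      have "1 - \<beta> = \<alpha> + \<gamma>" using abc(4) by linarith
      then show ?thesis unfolding b\<beta> by (simp only:) (simp add: algebra_simps)
    qed
    finally have "y / X powr \<alpha> \<le> \<alpha> * (y powr p * t powr - s / X) + \<beta> * (y powr p * t powr b) + \<gamma> * t powr - s"
      using weighted_AM_GM3[OF abc, of "y powr p * t powr - s / X" "y powr p * t powr b" "t powr - s"] y t X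
      by simp
    then show ?thesis using X by (simp add: divide_le_eq mult.commute)
  qed

  have bound: "ennreal (\<bar>\<phi> x\<bar> powr q) \<le> ennreal (c powr q) *
      ray_average (power_weight R (- s)) (\<lambda>y. ennreal (norm (grad \<phi> y) powr p)) x"
    if \<phi>: "\<phi> \<in> test_functions \<Omega>"
      and norm1: "(\<integral>\<^sup>+x. ennreal (norm (grad \<phi> x) powr p) \<partial>lborel) \<le> 1" for \<phi> x
  proof -
    have [measurable]: "grad \<phi> \<in> borel_measurable borel"
      by (intro borel_measurable_continuous_onI continuous_on_grad[OF \<phi>])
    define g where "g y = ennreal (norm (grad \<phi> y) powr p)" for y
    have g[measurable]: "g \<in> borel_measurable borel" unfolding g_def[abs_def] by measurable
    let ?X = "ray_average (power_weight R (- s)) g x"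
    \<comment> \<open>\<open>X\<close> plays the role of the first ray average in the normalised Hoelder inequality; allowing any larger value avoids a special case when that average is \<open>0\<close>\<close>
    have step: "\<bar>\<phi> x\<bar> powr q \<le> c powr q * X" if X: "X > 0" "?X \<le> ennreal X" for X
    proof -
      have pw: "indicator {0<..R} t * ennreal (norm (grad \<phi> y))
          \<le> ennreal (X powr \<alpha> * (\<alpha> / X)) * (power_weight R (- s) t * g y)
            + (ennreal (X powr \<alpha> * \<beta>) * (power_weight R b t * g y) + ennreal (X powr \<alpha> * \<gamma>) * power_weight R (- s) t)"
        for t y
      proof (cases "t \<in> {0<..R}")
        case True
        have "ennreal (norm (grad \<phi> y)) \<le> ennreal (X powr \<alpha> * (\<alpha> / X) * (t powr - s * norm (grad \<phi> y) powr p)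
            + (X powr \<alpha> * \<beta> * (t powr b * norm (grad \<phi> y) powr p) + X powr \<alpha> * \<gamma> * t powr - s))"
          using Young[of t X "norm (grad \<phi> y)"] True X by (intro ennreal_leI) (simp add: algebra_simps)
        also have "\<dots> = ennreal (X powr \<alpha> * (\<alpha> / X)) * (ennreal (t powr - s) * g y)
            + (ennreal (X powr \<alpha> * \<beta>) * (ennreal (t powr b) * g y) + ennreal (X powr \<alpha> * \<gamma>) * ennreal (t powr - s))"
        proof -
          define A1 A2 A3 where "A1 = X powr \<alpha> * (\<alpha> / X)" and "A2 = X powr \<alpha> * \<beta>" and "A3 = X powr \<alpha> * \<gamma>"
          have A: "A1 \<ge> 0" "A2 \<ge> 0" "A3 \<ge> 0" unfolding A1_def A2_def A3_def using X abc by auto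
          show ?thesis
            unfolding g_def A1_def[symmetric] A2_def[symmetric] A3_def[symmetric]
            using A by (simp add: ennreal_mult' ennreal_plus)
        qed
        finally show ?thesis using True unfolding power_weight_def by simp
      qed simp
      have "ray_average (indicator {0<..R}) (\<lambda>y. ennreal (norm (grad \<phi> y))) x
         \<le> (\<integral>\<^sup>+z. indicator ray_box z * (\<integral>\<^sup>+t. ennreal (X powr \<alpha> * (\<alpha> / X)) * (power_weight R (- s) t * g (x + t *\<^sub>R z))
            + (ennreal (X powr \<alpha> * \<beta>) * (power_weight R b t * g (x + t *\<^sub>R z))
              + ennreal (X powr \<alpha> * \<gamma>) * power_weight R (- s) t) \<partial>lborel) \<partial>lborel)"
        unfolding ray_average_def by (intro nn_integral_mono mult_left_mono pw) auto
      also have "\<dots> = ennreal (X powr \<alpha> * (\<alpha> / X)) * ?X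
          + (ennreal (X powr \<alpha> * \<beta>) * ray_average (power_weight R b) g x
            + ennreal (X powr \<alpha> * \<gamma>) * ray_average (power_weight R (- s)) (\<lambda>_. 1) x)"
        unfolding ray_average_def
        by (simp add: nn_integral_add nn_integral_cmult distrib_left mult.left_commute[of "indicator _ _"])
      also have "\<dots> \<le> ennreal (X powr \<alpha> * (\<alpha> / X)) * ennreal X
          + (ennreal (X powr \<alpha> * \<beta>) * ennreal Zb + ennreal (X powr \<alpha> * \<gamma>) * ennreal Zs)"
      proof (intro add_mono mult_left_mono)
        have "ray_average (power_weight R b) g x \<le> ennreal Zb * (\<integral>\<^sup>+z. g z \<partial>lborel)"
          using ray_average_bounded[OF g, of R b x] unfolding N_def[symmetric] Zb .
        also have "\<dots> \<le> ennreal Zb * 1"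
          using norm1 unfolding g_def by (rule mult_left_mono) simp
        finally show "ray_average (power_weight R b) g x \<le> ennreal Zb" by simp
      qed (use X ray_average_const[of "power_weight R (- s)" x] Zs in auto)
      also have "\<dots> = ennreal (X powr \<alpha> * (\<alpha> + D))"
        using X abc Zs0 Zb0 unfolding D_def
        by (simp add: ennreal_mult'[symmetric] ennreal_plus[symmetric] algebra_simps del: ennreal_plus)
      finally have "ennreal (2 * N) * ray_average (indicator {0<..R}) (\<lambda>y. ennreal (norm (grad \<phi> y))) x
          \<le> ennreal (2 * N) * ennreal (X powr \<alpha> * (\<alpha> + D))"
        by (rule mult_left_mono) simp
      also have "\<dots> = ennreal (c * X powr \<alpha>)"
        using N unfolding c_def by (simp add: ennreal_mult'[symmetric] algebra_simps)
      finally have "ennreal \<bar>\<phi> x\<bar> \<le> ennreal (c * X powr \<alpha>)"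
        using test_function_le_ray_average[OF \<phi> \<rho>(2) R, of x] unfolding N_def by (meson order_trans)
      then have "\<bar>\<phi> x\<bar> \<le> c * X powr \<alpha>" using c0 by (simp add: ennreal_le_iff)
      then have "\<bar>\<phi> x\<bar> powr q \<le> (c * X powr \<alpha>) powr q" using p q by (intro powr_mono2) auto
      also have "\<dots> = c powr q * X"
        using c0 X p q unfolding \<alpha>_def by (simp add: powr_mult powr_powr)
      finally show ?thesis .
    qed
    show ?thesis
    proof (cases "?X = \<infinity>")
      case True
      then show ?thesis unfolding g_def[symmetric] using c0 by (simp add: ennreal_mult_top)
    next
      case False
      then obtain X where X: "X \<ge> 0" "?X = ennreal X" by (metis ennreal_cases infinity_ennreal_def)
      have "\<bar>\<phi> x\<bar> powr q \<le> c powr q * X + e" if "e > 0" for e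
      proof -
        have "\<bar>\<phi> x\<bar> powr q \<le> c powr q * (X + e / c powr q)"
          using X c0 \<open>e > 0\<close> by (intro step) (auto intro!: ennreal_leI add_nonneg_pos)
        then show ?thesis using c0 by (simp add: distrib_left)
      qed
      then have "\<bar>\<phi> x\<bar> powr q \<le> c powr q * X" by (rule field_le_epsilon)
      then show ?thesis unfolding g_def[symmetric] X(2) by (simp add: ennreal_mult'[symmetric] ennreal_leI)
    qed
  qed

  have "(\<integral>\<^sup>+x. ennreal (\<bar>\<phi> x\<bar> powr q) \<partial>lborel) \<le> ennreal (c powr q * Zs + 1)"
    if \<phi>: "\<phi> \<in> test_functions \<Omega>"
      and norm1: "(\<integral>\<^sup>+x. ennreal (norm (grad \<phi> x) powr p) \<partial>lborel) \<le> 1" for \<phi>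
  proof -
    have [measurable]: "grad \<phi> \<in> borel_measurable borel"
      by (intro borel_measurable_continuous_onI continuous_on_grad[OF \<phi>])
    let ?g = "\<lambda>y. ennreal (norm (grad \<phi> y) powr p)"
    have "(\<integral>\<^sup>+x. ennreal (\<bar>\<phi> x\<bar> powr q) \<partial>lborel)
        \<le> (\<integral>\<^sup>+x. ennreal (c powr q) * ray_average (power_weight R (- s)) ?g x \<partial>lborel)"
      by (intro nn_integral_mono bound \<phi> norm1)
    also have "\<dots> = ennreal (c powr q) * (\<integral>\<^sup>+x. ray_average (power_weight R (- s)) ?g x \<partial>lborel)"
      unfolding ray_average_def by (rule nn_integral_cmult) measurable
    also have "(\<integral>\<^sup>+x. ray_average (power_weight R (- s)) ?g x \<partial>lborel) = ennreal Zs * (\<integral>\<^sup>+x. ?g x \<partial>lborel)"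
      by (subst nn_integral_ray_average) (auto simp: Zs)
    also have "ennreal (c powr q) * \<dots> \<le> ennreal (c powr q) * (ennreal Zs * 1)"
      using norm1 by (intro mult_left_mono) auto
    also have "\<dots> \<le> ennreal (c powr q * Zs + 1)"
      by (simp add: ennreal_mult'[symmetric] ennreal_leI)
    finally show ?thesis .
  qed
  moreover have "c powr q * Zs + 1 > 0" using Zs0 by (simp add: add_nonneg_pos)
  ultimately show ?thesis by blast
qed

lemma test_function_cmult:
  assumes \<phi>: "\<phi> \<in> test_functions \<Omega>"
  shows "(\<lambda>x. k * \<phi> x) \<in> test_functions \<Omega>"
proof -
  have "Ck_on j UNIV (\<lambda>x. k * \<phi> x)" for j
    using \<phi> unfolding test_functions_def smooth_on_def
    by (intro Ck_on_mult Ck_on_const) blast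
  moreover obtain K where K: "compact K" "K \<subseteq> \<Omega>" "\<And>x. x \<notin> K \<Longrightarrow> \<phi> x = 0"
    using test_function_support[OF \<phi>] by blast
  ultimately show ?thesis
    unfolding test_functions_def smooth_on_def
    by (intro CollectI conjI allI exI[of _ K]) auto
qed

lemma grad_cmult:
  assumes \<phi>: "\<phi> \<in> test_functions \<Omega>"
  shows "grad (\<lambda>x. k * \<phi> x) x = k *\<^sub>R grad \<phi> x"
proof -
  have "frechet_derivative (\<lambda>x. k * \<phi> x) (at x) = (\<lambda>i. k * frechet_derivative \<phi> (at x) i)"
    by (rule frechet_derivative_eqI) (intro has_derivative_mult_right test_function_has_derivative[OF \<phi>])
  then show ?thesis unfolding grad_def by (simp add: scaleR_sum_right)
qed

text \<open>Homogeneity removes the normalisation of the gradient. The bound \<open>B\<close> is kept positive so that it can be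
divided out.\<close>

theorem subcritical_sobolev:
  fixes \<Omega> :: "'a::euclidean_space set"
  assumes bdd: "bounded \<Omega>" and p: "1 < p" and q: "p < q" and sub: "DIM('a) * (1 / p - 1 / q) < 1"
  shows "\<exists>C>0. \<forall>\<phi>\<in>test_functions \<Omega>. \<forall>B>0.
     (\<integral>\<^sup>+x. ennreal (norm (grad \<phi> x) powr p) \<partial>lborel) \<le> ennreal B \<longrightarrow>
     (\<integral>\<^sup>+x. ennreal (\<bar>\<phi> x\<bar> powr q) \<partial>lborel) \<le> ennreal (C * B powr (q / p))"
proof -
  obtain C where C: "C > 0" "\<And>\<phi>. \<phi> \<in> test_functions \<Omega> \<Longrightarrow>
     (\<integral>\<^sup>+x. ennreal (norm (grad \<phi> x) powr p) \<partial>lborel) \<le> 1 \<Longrightarrow>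
     (\<integral>\<^sup>+x. ennreal (\<bar>\<phi> x\<bar> powr q) \<partial>lborel) \<le> ennreal C"
    using subcritical_sobolev_normalised[OF assms] by blast
  have "(\<integral>\<^sup>+x. ennreal (\<bar>\<phi> x\<bar> powr q) \<partial>lborel) \<le> ennreal (C * B powr (q / p))"
    if \<phi>: "\<phi> \<in> test_functions \<Omega>" and B: "B > 0"
      and le: "(\<integral>\<^sup>+x. ennreal (norm (grad \<phi> x) powr p) \<partial>lborel) \<le> ennreal B" for \<phi> B
  proof -
    define k where "k = B powr (- 1 / p)"
    have k: "k > 0" "k powr p = 1 / B" "k powr q = B powr (- (q / p))"
      unfolding k_def using B p by (auto simp: powr_powr powr_minus_divide powr_divide)
    have [measurable]: "grad \<phi> \<in> borel_measurable borel" "\<phi> \<in> borel_measurable borel"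
      by (auto intro: borel_measurable_continuous_onI continuous_on_grad[OF \<phi>] test_function_borel[OF \<phi>])
    have "(\<integral>\<^sup>+x. ennreal (norm (grad (\<lambda>x. k * \<phi> x) x) powr p) \<partial>lborel)
        = (\<integral>\<^sup>+x. ennreal (1 / B) * ennreal (norm (grad \<phi> x) powr p) \<partial>lborel)"
      unfolding grad_cmult[OF \<phi>] using k B by (simp add: powr_mult ennreal_mult'[symmetric])
    also have "\<dots> = ennreal (1 / B) * (\<integral>\<^sup>+x. ennreal (norm (grad \<phi> x) powr p) \<partial>lborel)"
      by (rule nn_integral_cmult) measurable
    also have "\<dots> \<le> ennreal (1 / B) * ennreal B" using le by (rule mult_left_mono) simp
    also have "\<dots> = 1" using B by (simp add: ennreal_mult'[symmetric])
    finally have "(\<integral>\<^sup>+x. ennreal (\<bar>k * \<phi> x\<bar> powr q) \<partial>lborel) \<le> ennreal C"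
      using C(2)[OF test_function_cmult[OF \<phi>]] by simp
    also have "(\<integral>\<^sup>+x. ennreal (\<bar>k * \<phi> x\<bar> powr q) \<partial>lborel)
        = (\<integral>\<^sup>+x. ennreal (k powr q) * ennreal (\<bar>\<phi> x\<bar> powr q) \<partial>lborel)"
      using k by (simp add: abs_mult powr_mult ennreal_mult'[symmetric])
    also have "\<dots> = ennreal (k powr q) * (\<integral>\<^sup>+x. ennreal (\<bar>\<phi> x\<bar> powr q) \<partial>lborel)"
      by (rule nn_integral_cmult) measurable
    finally have "ennreal (B powr (q / p)) * (ennreal (k powr q) * (\<integral>\<^sup>+x. ennreal (\<bar>\<phi> x\<bar> powr q) \<partial>lborel))
        \<le> ennreal (B powr (q / p)) * ennreal C"
      by (rule mult_left_mono) simp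
    moreover have "ennreal (B powr (q / p)) * ennreal (k powr q) = 1"
      unfolding k(3) using B by (simp add: ennreal_mult'[symmetric] powr_add[symmetric])
    ultimately show ?thesis
      using C(1) by (simp add: mult.assoc[symmetric]) (simp add: ennreal_mult' mult.commute)
  qed
  then show ?thesis using C(1) by blast
qed

section \<open>The Sobolev constants\<close>

lemma Lp_norm_powr:
  fixes f :: "'a::euclidean_space \<Rightarrow> 'b::euclidean_space"
  assumes "s > 0"
  shows "Lp_norm s \<Omega> f powr t = (LINT x|lebesgue_on \<Omega>. norm (f x) powr s) powr (t / s)"
  unfolding Lp_norm_def by (simp add: powr_powr)

text \<open>A crude substitute for Minkowski's inequality; constants do not matter for positivity of the
Sobolev constants.\<close>

lemma powr_add_le:
  fixes a b p :: real
  assumes "a \<ge> 0" "b \<ge> 0" "p > 0"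
  shows "(a + b) powr p \<le> 2 powr p * (a powr p + b powr p)"
proof -
  have "(a + b) powr p \<le> (2 * max a b) powr p" using assms by (intro powr_mono2) auto
  also have "\<dots> = 2 powr p * max a b powr p" using assms by (simp add: powr_mult)
  also have "max a b powr p \<le> a powr p + b powr p" by (simp add: max_def)
  finally show ?thesis by simp
qed

text \<open>Completeness of Lebesgue measure. It makes the integrals of the chosen weak gradient agree with those
of any other weak gradient.\<close>

lemma measurable_lebesgue_on_AE:
  fixes f g :: "'a::euclidean_space \<Rightarrow> 'b::euclidean_space"
  assumes \<Omega>: "open \<Omega>" and f: "f \<in> borel_measurable (lebesgue_on \<Omega>)"
    and ae: "AE x in lebesgue_on \<Omega>. f x = g x"
  shows "g \<in> borel_measurable (lebesgue_on \<Omega>)"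
proof -
  have s: "\<Omega> \<inter> space lebesgue \<in> sets lebesgue" using \<Omega> by auto
  have "(\<lambda>x. indicator \<Omega> x *\<^sub>R g x) \<in> borel_measurable lebesgue"
  proof (rule borel_measurable_AE)
    show "(\<lambda>x. indicator \<Omega> x *\<^sub>R f x) \<in> borel_measurable lebesgue"
      using f by (subst (asm) borel_measurable_restrict_space_iff[OF s])
    have "AE x in lebesgue. x \<in> \<Omega> \<longrightarrow> f x = g x"
      using ae by (subst (asm) AE_restrict_space_iff[OF s])
    then show "AE x in lebesgue. indicat_real \<Omega> x *\<^sub>R f x = indicat_real \<Omega> x *\<^sub>R g x"
      by eventually_elim (auto simp: indicator_def)
  qed
  then show ?thesis by (subst borel_measurable_restrict_space_iff[OF s])
qed

lemma integrable_bounded_support: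
  fixes f :: "'a::euclidean_space \<Rightarrow> 'b::euclidean_space"
  assumes f: "continuous_on UNIV f" and K: "compact K" "\<And>x. x \<notin> K \<Longrightarrow> f x = 0" and s: "s > 0"
  shows "integrable lborel (\<lambda>x. norm (f x) powr s)"
proof -
  have "continuous_on K (\<lambda>x. norm (f x) powr s)"
    using s by (intro continuous_on_powr' continuous_intros continuous_on_subset[OF f]) auto
  then have "integrable lborel (\<lambda>x. indicator K x *\<^sub>R (norm (f x) powr s))"
    by (rule borel_integrable_compact[OF K(1)])
  moreover have "(\<lambda>x. indicator K x *\<^sub>R (norm (f x) powr s)) = (\<lambda>x. norm (f x) powr s)"
    using K(2) s by (force simp: indicator_def)
  ultimately show ?thesis by simp
qed

lemma lebesgue_on_integral_eq:
  fixes f :: "'a::euclidean_space \<Rightarrow> real"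
  assumes \<Omega>: "open \<Omega>" and f: "integrable lborel f" "\<And>x. x \<notin> \<Omega> \<Longrightarrow> f x = 0" and nn: "\<And>x. f x \<ge> 0"
  shows "integrable (lebesgue_on \<Omega>) f"
    and "(\<integral>\<^sup>+x. ennreal (f x) \<partial>lborel) = ennreal (LINT x|lebesgue_on \<Omega>. f x)"
proof -
  have eq: "(\<lambda>x. indicator \<Omega> x *\<^sub>R f x) = f" using f(2) by (force simp: indicator_def)
  have m: "f \<in> borel_measurable lborel" using f(1) by simp
  have int: "integrable lebesgue f" using f(1) integrable_completion[OF m] by simp
  then show "integrable (lebesgue_on \<Omega>) f" using \<Omega> eq by (simp add: integrable_restrict_space)
  have "(LINT x|lebesgue_on \<Omega>. f x) = (LINT x|lborel. f x)"
    using \<Omega> eq integral_completion[OF m] by (simp add: integral_restrict_space)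
  then show "(\<integral>\<^sup>+x. ennreal (f x) \<partial>lborel) = ennreal (LINT x|lebesgue_on \<Omega>. f x)"
    using nn_integral_eq_integral[OF f(1)] nn by simp
qed

lemma grad_support:
  assumes \<phi>: "\<phi> \<in> test_functions \<Omega>"
  obtains K where "compact K" "K \<subseteq> \<Omega>" "\<And>x. x \<notin> K \<Longrightarrow> grad \<phi> x = 0"
proof -
  have "\<exists>K. compact K \<and> K \<subseteq> \<Omega> \<and> (\<forall>x. x \<notin> K \<longrightarrow> frechet_derivative \<phi> (at x) i = 0)" if "i \<in> Basis" for i
    using test_function_support[OF test_function_partial[OF \<phi> that]] by metis
  then obtain K where K: "\<And>i. i \<in> Basis \<Longrightarrow> compact (K i) \<and> K i \<subseteq> \<Omega> \<and> (\<forall>x. x \<notin> K i \<longrightarrow> frechet_derivative \<phi> (at x) i = 0)"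
    by metis
  show ?thesis
  proof (rule that[of "\<Union>i\<in>Basis. K i"])
    show "compact (\<Union>i\<in>Basis. K i)" using K by (intro compact_UN) auto
    show "(\<Union>i\<in>Basis. K i) \<subseteq> \<Omega>" using K by auto
    show "grad \<phi> x = 0" if "x \<notin> (\<Union>i\<in>Basis. K i)" for x
      unfolding grad_def using that K by (intro sum.neutral) auto
  qed
qed

lemma test_function_Lp:
  assumes \<Omega>: "open \<Omega>" and \<phi>: "\<phi> \<in> test_functions \<Omega>" and s: "s > 0"
  shows "integrable (lebesgue_on \<Omega>) (\<lambda>x. \<bar>\<phi> x\<bar> powr s)"
    and "(\<integral>\<^sup>+x. ennreal (\<bar>\<phi> x\<bar> powr s) \<partial>lborel) = ennreal (LINT x|lebesgue_on \<Omega>. \<bar>\<phi> x\<bar> powr s)"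
proof -
  obtain K where K: "compact K" "K \<subseteq> \<Omega>" "\<And>x. x \<notin> K \<Longrightarrow> \<phi> x = 0"
    using test_function_support[OF \<phi>] by blast
  have "integrable lborel (\<lambda>x. \<bar>\<phi> x\<bar> powr s)"
    using integrable_bounded_support[OF test_function_continuous[OF \<phi>] K(1,3) s] by simp
  from lebesgue_on_integral_eq[OF \<Omega> this]
  show "integrable (lebesgue_on \<Omega>) (\<lambda>x. \<bar>\<phi> x\<bar> powr s)"
    "(\<integral>\<^sup>+x. ennreal (\<bar>\<phi> x\<bar> powr s) \<partial>lborel) = ennreal (LINT x|lebesgue_on \<Omega>. \<bar>\<phi> x\<bar> powr s)"
    using K(2,3) by force+
qed

lemma grad_Lp:
  assumes \<Omega>: "open \<Omega>" and \<phi>: "\<phi> \<in> test_functions \<Omega>" and s: "s > 0"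
  shows "integrable (lebesgue_on \<Omega>) (\<lambda>x. norm (grad \<phi> x) powr s)"
    and "(\<integral>\<^sup>+x. ennreal (norm (grad \<phi> x) powr s) \<partial>lborel) = ennreal (LINT x|lebesgue_on \<Omega>. norm (grad \<phi> x) powr s)"
proof -
  obtain K where K: "compact K" "K \<subseteq> \<Omega>" "\<And>x. x \<notin> K \<Longrightarrow> grad \<phi> x = 0"
    using grad_support[OF \<phi>] by blast
  have "integrable lborel (\<lambda>x. norm (grad \<phi> x) powr s)"
    by (rule integrable_bounded_support[OF continuous_on_grad[OF \<phi>] K(1,3) s])
  from lebesgue_on_integral_eq[OF \<Omega> this]
  show "integrable (lebesgue_on \<Omega>) (\<lambda>x. norm (grad \<phi> x) powr s)"
    "(\<integral>\<^sup>+x. ennreal (norm (grad \<phi> x) powr s) \<partial>lborel) = ennreal (LINT x|lebesgue_on \<Omega>. norm (grad \<phi> x) powr s)"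
    using K(2,3) by force+
qed

lemma integrable_powr_diff:
  fixes f g :: "'a \<Rightarrow> 'b::euclidean_space"
  assumes [measurable]: "f \<in> borel_measurable M" "g \<in> borel_measurable M"
    and f: "integrable M (\<lambda>x. norm (f x) powr p)" and g: "integrable M (\<lambda>x. norm (g x) powr p)" and p: "p > 0"
  shows "integrable M (\<lambda>x. norm (f x - g x) powr p)"
    and "(\<integral>x. norm (f x - g x) powr p \<partial>M) \<le> 2 powr p * ((\<integral>x. norm (f x) powr p \<partial>M) + (\<integral>x. norm (g x) powr p \<partial>M))"
proof -
  have le: "norm (f x - g x) powr p \<le> 2 powr p * (norm (f x) powr p + norm (g x) powr p)" for x
  proof -
    have "norm (f x - g x) powr p \<le> (norm (f x) + norm (g x)) powr p"
      using p norm_triangle_ineq4 by (intro powr_mono2) auto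
    also have "\<dots> \<le> 2 powr p * (norm (f x) powr p + norm (g x) powr p)"
      by (rule powr_add_le) (use p in auto)
    finally show ?thesis .
  qed
  have int: "integrable M (\<lambda>x. 2 powr p * (norm (f x) powr p + norm (g x) powr p))"
    using f g by simp
  show I: "integrable M (\<lambda>x. norm (f x - g x) powr p)"
    by (rule Bochner_Integration.integrable_bound[OF int]) (use le in \<open>auto intro!: AE_I2\<close>)
  have "(\<integral>x. norm (f x - g x) powr p \<partial>M) \<le> (\<integral>x. 2 powr p * (norm (f x) powr p + norm (g x) powr p) \<partial>M)"
    by (rule integral_mono[OF I int le])
  also have "\<dots> = 2 powr p * ((\<integral>x. norm (f x) powr p \<partial>M) + (\<integral>x. norm (g x) powr p \<partial>M))"
    using f g by simp
  finally show "(\<integral>x. norm (f x - g x) powr p \<partial>M) \<le> 2 powr p * ((\<integral>x. norm (f x) powr p \<partial>M) + (\<integral>x. norm (g x) powr p \<partial>M))" .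
qed

lemma test_function_measurable:
  assumes "\<phi> \<in> test_functions \<Omega>"
  shows "\<phi> \<in> borel_measurable (lebesgue_on \<Omega>)" "grad \<phi> \<in> borel_measurable (lebesgue_on \<Omega>)"
proof -
  have "\<phi> \<in> borel_measurable lebesgue" "grad \<phi> \<in> borel_measurable lebesgue"
    using borel_measurable_continuous_onI[OF test_function_continuous[OF assms]]
      borel_measurable_continuous_onI[OF continuous_on_grad[OF assms]]
    by (auto intro: measurable_completion)
  then show "\<phi> \<in> borel_measurable (lebesgue_on \<Omega>)" "grad \<phi> \<in> borel_measurable (lebesgue_on \<Omega>)"
    by (auto intro: measurable_restrict_space1)
qed

lemma W1p_weak_gradient:
  assumes \<Omega>: "open \<Omega>" and u: "u \<in> W1p p \<Omega>"
  shows "has_weak_gradient \<Omega> u (weak_gradient \<Omega> u)" "weak_gradient \<Omega> u \<in> Lp_space p \<Omega>"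
proof -
  obtain g where g: "g \<in> Lp_space p \<Omega>" "has_weak_gradient \<Omega> u g" using u unfolding W1p_def by blast
  show w: "has_weak_gradient \<Omega> u (weak_gradient \<Omega> u)" by (rule has_weak_gradient_weak_gradient[OF g(2)])
  have ae: "AE x in lebesgue_on \<Omega>. g x = weak_gradient \<Omega> u x"
    by (rule has_weak_gradient_unique[OF \<Omega> g(2) w])
  have m: "g \<in> borel_measurable (lebesgue_on \<Omega>)" and i: "integrable (lebesgue_on \<Omega>) (\<lambda>x. norm (g x) powr p)"
    using g(1) unfolding Lp_space_def by auto
  note [measurable] = m measurable_lebesgue_on_AE[OF \<Omega> m ae]
  have "integrable (lebesgue_on \<Omega>) (\<lambda>x. norm (weak_gradient \<Omega> u x) powr p)"
    using i by (rule integrable_cong_AE_imp) (use ae in \<open>auto\<close>)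
  then show "weak_gradient \<Omega> u \<in> Lp_space p \<Omega>"
    using measurable_lebesgue_on_AE[OF \<Omega> m ae] unfolding Lp_space_def by simp
qed

text \<open>Uniqueness of weak gradients identifies the gradient of \<open>\<phi>\<close> with the difference of the chosen
gradients of \<open>u\<close> and of \<open>u - \<phi>\<close>, which transfers the bound on the latter to \<open>grad \<phi>\<close>.\<close>

lemma W1p_0_approximation:
  assumes \<Omega>: "open \<Omega>" and p: "p > 0" and u: "u \<in> W1p_0 p \<Omega>" and \<epsilon>: "0 < \<epsilon>" "\<epsilon> \<le> 1"
  obtains \<phi> where "\<phi> \<in> test_functions \<Omega>"
    "integrable (lebesgue_on \<Omega>) (\<lambda>x. \<bar>u x - \<phi> x\<bar> powr p)"
    "(LINT x|lebesgue_on \<Omega>. \<bar>u x - \<phi> x\<bar> powr p) \<le> \<epsilon> powr p"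
    "(LINT x|lebesgue_on \<Omega>. norm (grad \<phi> x) powr p)
      \<le> 2 powr p * ((LINT x|lebesgue_on \<Omega>. norm (weak_gradient \<Omega> u x) powr p) + \<epsilon> powr p)"
proof -
  have uW: "u \<in> W1p p \<Omega>" using u unfolding W1p_0_def by simp
  obtain \<phi> where \<phi>: "\<phi> \<in> test_functions \<Omega>" and lt: "W1p_norm p \<Omega> (\<lambda>x. u x - \<phi> x) < \<epsilon>"
    using u \<epsilon> unfolding W1p_0_def by blast
  let ?M = "lebesgue_on \<Omega>"
  define G where "G = weak_gradient \<Omega> u"
  define w where "w = weak_gradient \<Omega> (\<lambda>x. u x - \<phi> x)"
  define d where "d x = G x - grad \<phi> x" for x
  have wG: "has_weak_gradient \<Omega> u G" and GL: "G \<in> Lp_space p \<Omega>"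
    unfolding G_def using W1p_weak_gradient[OF \<Omega> uW] by auto
  have hd: "has_weak_gradient \<Omega> (\<lambda>x. u x - \<phi> x) d"
    unfolding d_def by (rule has_weak_gradient_diff[OF \<Omega> wG has_weak_gradient_test_function[OF \<Omega> \<phi>]])
  have ae: "AE x in ?M. d x = w x"
    unfolding w_def by (rule has_weak_gradient_unique[OF \<Omega> hd has_weak_gradient_weak_gradient[OF hd]])
  note m = test_function_measurable[OF \<phi>]
  have Gm[measurable]: "G \<in> borel_measurable ?M" and Gi: "integrable ?M (\<lambda>x. norm (G x) powr p)"
    using GL unfolding Lp_space_def by auto
  have um: "u \<in> borel_measurable ?M" and ui: "integrable ?M (\<lambda>x. norm (u x) powr p)"
    using uW unfolding W1p_def Lp_space_def by auto
  have dm[measurable]: "d \<in> borel_measurable ?M" unfolding d_def[abs_def] using m by measurable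
  have wm[measurable]: "w \<in> borel_measurable ?M" by (rule measurable_lebesgue_on_AE[OF \<Omega> dm ae])
  have di: "integrable ?M (\<lambda>x. norm (d x) powr p)"
    unfolding d_def by (rule integrable_powr_diff(1)[OF Gm m(2) Gi grad_Lp(1)[OF \<Omega> \<phi> p] p])
  have I1: "integrable ?M (\<lambda>x. \<bar>u x - \<phi> x\<bar> powr p)"
    using integrable_powr_diff(1)[OF um m(1) ui _ p] test_function_Lp(1)[OF \<Omega> \<phi> p] by simp
  have wd: "(LINT x|?M. norm (w x) powr p) = (LINT x|?M. norm (d x) powr p)"
    by (rule integral_cong_AE) (use ae in auto)
  have nn: "(LINT x|?M. \<bar>u x - \<phi> x\<bar> powr p) \<ge> 0" "(LINT x|?M. norm (d x) powr p) \<ge> 0" by auto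
  have "((LINT x|?M. \<bar>u x - \<phi> x\<bar> powr p) + (LINT x|?M. norm (d x) powr p)) powr (1 / p) < \<epsilon>"
    using lt p wd unfolding W1p_norm_def w_def[symmetric] by (simp add: Lp_norm_powr)
  then have "(((LINT x|?M. \<bar>u x - \<phi> x\<bar> powr p) + (LINT x|?M. norm (d x) powr p)) powr (1 / p)) powr p \<le> \<epsilon> powr p"
    using p by (intro powr_mono2) auto
  then have le: "(LINT x|?M. \<bar>u x - \<phi> x\<bar> powr p) + (LINT x|?M. norm (d x) powr p) \<le> \<epsilon> powr p"
    using p nn by (simp add: powr_powr)
  have "(LINT x|?M. norm (grad \<phi> x) powr p) = (LINT x|?M. norm (G x - d x) powr p)"
    unfolding d_def by simp
  also have "\<dots> \<le> 2 powr p * ((LINT x|?M. norm (G x) powr p) + (LINT x|?M. norm (d x) powr p))"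
    by (rule integrable_powr_diff(2)[OF Gm dm Gi di p])
  also have "\<dots> \<le> 2 powr p * ((LINT x|?M. norm (G x) powr p) + \<epsilon> powr p)"
  proof (intro mult_left_mono add_left_mono)
    show "(LINT x|?M. norm (d x) powr p) \<le> \<epsilon> powr p" using le nn(1) by linarith
  qed simp
  finally show ?thesis
    using that[OF \<phi> I1] le nn unfolding G_def by linarith
qed

text \<open>Test functions approximating \<open>u\<close> in \<open>L\<^sup>p\<close> converge almost everywhere along a subsequence, and their
\<open>L\<^sup>q\<close> norms are bounded by their gradients; Fatou's lemma passes this bound to \<open>u\<close>.\<close>

theorem W1p_0_subcritical_embedding:
  fixes \<Omega> :: "'a::euclidean_space set"
  assumes \<Omega>: "open \<Omega>" "bounded \<Omega>" and p: "1 < p" and q: "p < q" and sub: "DIM('a) * (1 / p - 1 / q) < 1"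
  shows "\<exists>C>0. \<forall>u\<in>W1p_0 p \<Omega>. integrable (lebesgue_on \<Omega>) (\<lambda>x. \<bar>u x\<bar> powr q) \<and>
     (LINT x|lebesgue_on \<Omega>. \<bar>u x\<bar> powr q)
       \<le> C * (LINT x|lebesgue_on \<Omega>. norm (weak_gradient \<Omega> u x) powr p) powr (q / p)"
proof -
  let ?M = "lebesgue_on \<Omega>"
  obtain C where C: "C > 0" "\<And>\<phi> B. \<phi> \<in> test_functions \<Omega> \<Longrightarrow> B > 0 \<Longrightarrow>
     (\<integral>\<^sup>+x. ennreal (norm (grad \<phi> x) powr p) \<partial>lborel) \<le> ennreal B \<Longrightarrow>
     (\<integral>\<^sup>+x. ennreal (\<bar>\<phi> x\<bar> powr q) \<partial>lborel) \<le> ennreal (C * B powr (q / p))"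
    using subcritical_sobolev[OF \<Omega>(2) p q sub] by blast
  have p0: "p > 0" "q > 0" using p q by auto
  have "integrable ?M (\<lambda>x. \<bar>u x\<bar> powr q) \<and> (LINT x|?M. \<bar>u x\<bar> powr q)
       \<le> C * (2 powr p) powr (q / p) * (LINT x|?M. norm (weak_gradient \<Omega> u x) powr p) powr (q / p)"
    if u: "u \<in> W1p_0 p \<Omega>" for u
  proof -
    define A where "A = (LINT x|?M. norm (weak_gradient \<Omega> u x) powr p)"
    have A0: "A \<ge> 0" unfolding A_def by simp
    define \<epsilon> where "\<epsilon> n = inverse (real (Suc n))" for n
    have \<epsilon>: "0 < \<epsilon> n" "\<epsilon> n \<le> 1" for n unfolding \<epsilon>_def by (auto simp: inverse_le_1_iff)
    have \<epsilon>_lim: "(\<lambda>n. \<epsilon> n powr p) \<longlonglongrightarrow> 0"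
      using tendsto_powr'[OF LIMSEQ_inverse_real_of_nat tendsto_const, of p] p0 unfolding \<epsilon>_def by simp
    define Q where "Q n \<phi> \<longleftrightarrow> \<phi> \<in> test_functions \<Omega> \<and> integrable ?M (\<lambda>x. \<bar>u x - \<phi> x\<bar> powr p) \<and>
        (LINT x|?M. \<bar>u x - \<phi> x\<bar> powr p) \<le> \<epsilon> n powr p \<and>
        (LINT x|?M. norm (grad \<phi> x) powr p) \<le> 2 powr p * (A + \<epsilon> n powr p)" for n \<phi>
    have "\<exists>\<phi>. Q n \<phi>" for n
      by (rule W1p_0_approximation[OF \<Omega>(1) p0(1) u \<epsilon>(1)[of n] \<epsilon>(2)[of n]], rule exI)
        (simp add: Q_def A_def)
    then obtain \<phi> where "\<And>n. Q n (\<phi> n)" by metis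
    then have \<phi>: "\<And>n. \<phi> n \<in> test_functions \<Omega>"
      and int: "\<And>n. integrable ?M (\<lambda>x. \<bar>u x - \<phi> n x\<bar> powr p)"
      and small: "\<And>n. (LINT x|?M. \<bar>u x - \<phi> n x\<bar> powr p) \<le> \<epsilon> n powr p"
      and gr: "\<And>n. (LINT x|?M. norm (grad (\<phi> n) x) powr p) \<le> 2 powr p * (A + \<epsilon> n powr p)"
      unfolding Q_def by auto
    have "(\<lambda>n. LINT x|?M. norm (\<bar>u x - \<phi> n x\<bar> powr p)) \<longlonglongrightarrow> 0"
      by (rule tendsto_sandwich[OF _ _ tendsto_const \<epsilon>_lim]) (use small in auto)
    from tendsto_L1_AE_subseq[OF int this]
    obtain r where r: "strict_mono r" "AE x in ?M. (\<lambda>n. \<bar>u x - \<phi> (r n) x\<bar> powr p) \<longlonglongrightarrow> 0" by blast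
    define c where "c n = C * (2 powr p * (A + \<epsilon> n powr p)) powr (q / p)" for n
    have bd: "(LINT x|?M. \<bar>\<phi> n x\<bar> powr q) \<le> c n" for n
    proof -
      have B: "2 powr p * (A + \<epsilon> n powr p) > 0" using A0 \<epsilon>(1)[of n] by (simp add: add_nonneg_pos)
      have "(\<integral>\<^sup>+x. ennreal (norm (grad (\<phi> n) x) powr p) \<partial>lborel) \<le> ennreal (2 powr p * (A + \<epsilon> n powr p))"
        unfolding grad_Lp(2)[OF \<Omega>(1) \<phi> p0(1)] by (rule ennreal_leI[OF gr])
      from C(2)[OF \<phi> B this] show ?thesis
        unfolding test_function_Lp(2)[OF \<Omega>(1) \<phi> p0(2)] c_def using C(1) by simp
    qed
    have c_lim: "c \<longlonglongrightarrow> C * (2 powr p * (A + 0)) powr (q / p)"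
      unfolding c_def[abs_def]
      using p0 A0 by (intro tendsto_intros tendsto_powr' \<epsilon>_lim) (auto intro!: always_eventually)
    have "integrable ?M (\<lambda>x. \<bar>u x\<bar> powr q) \<and> (LINT x|?M. \<bar>u x\<bar> powr q) \<le> C * (2 powr p * (A + 0)) powr (q / p)"
    proof (rule integrable_Fatou[where f = "\<lambda>n x. \<bar>\<phi> (r n) x\<bar> powr q" and c = "\<lambda>n. c (r n)"])
      show "integrable ?M (\<lambda>x. \<bar>\<phi> (r n) x\<bar> powr q)" for n
        by (rule test_function_Lp(1)[OF \<Omega>(1) \<phi> p0(2)])
      show "(\<lambda>x. \<bar>u x\<bar> powr q) \<in> borel_measurable ?M"
        using u unfolding W1p_0_def W1p_def Lp_space_def by auto
      show "AE x in ?M. (\<lambda>n. \<bar>\<phi> (r n) x\<bar> powr q) \<longlonglongrightarrow> \<bar>u x\<bar> powr q"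
        using r(2)
      proof eventually_elim
        case (elim x)
        have "(\<lambda>n. (\<bar>u x - \<phi> (r n) x\<bar> powr p) powr (1 / p)) \<longlonglongrightarrow> 0 powr (1 / p)"
          using p0 by (intro tendsto_powr' elim tendsto_const) auto
        then have "(\<lambda>n. \<bar>u x - \<phi> (r n) x\<bar>) \<longlonglongrightarrow> 0" using p0 by (simp add: powr_powr)
        then have "(\<lambda>n. u x - (u x - \<phi> (r n) x)) \<longlonglongrightarrow> u x - 0"
          by (intro tendsto_diff tendsto_const) (simp add: tendsto_rabs_zero_iff)
        then have "(\<lambda>n. \<phi> (r n) x) \<longlonglongrightarrow> u x" by simp
        then show ?case
          using p0 by (intro tendsto_powr' tendsto_rabs tendsto_const) auto
      qed
      show "(\<lambda>n. c (r n)) \<longlonglongrightarrow> C * (2 powr p * (A + 0)) powr (q / p)"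
        using LIMSEQ_subseq_LIMSEQ[OF c_lim r(1)] by (simp add: o_def)
    qed (use bd in auto)
    then show ?thesis using A0 unfolding A_def[symmetric] by (simp add: powr_mult mult.assoc)
  qed
  moreover have "C * (2 powr p) powr (q / p) > 0" using C(1) by simp
  ultimately show ?thesis by blast
qed

theorem theorem10:
  fixes \<Omega> :: "(real ^ 'N) set" and p :: real
  assumes "CARD('N) \<ge> 2"
    and "1 < p" and "p < real CARD('N)"
    and "bounded_smooth_domain \<Omega>"
  shows "absolutely_continuous_on_interval 1 (critical_exponent CARD('N) p) (sobolev_const p \<Omega>)"
proof -
  let ?M = "lebesgue_on \<Omega>"
  define N where "N = real CARD('N)"
  define P where "P = critical_exponent CARD('N) p"
  define U where "U = {u \<in> W1p_0 p \<Omega>. \<not> (AE x in ?M. u x = 0)}"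
  define E where "E u = Lp_norm p \<Omega> (weak_gradient \<Omega> u) powr p" for u
  have p: "1 < p" "p < N" using assms unfolding N_def by auto
  have \<Omega>: "open \<Omega>" "bounded \<Omega>" "\<Omega> \<noteq> {}" using assms(4) unfolding bounded_smooth_domain_def by auto
  have PN: "P = N * p / (N - p)" unfolding P_def critical_exponent_def N_def ..
  have "p < P"
  proof -
    have "p * (N - p) < N * p" using p by (simp add: algebra_simps)
    then show ?thesis unfolding PN using p by (simp add: less_divide_eq)
  qed
  then have P1: "P > 1" using p by simp
  have lm: "\<Omega> \<in> lmeasurable" using \<Omega> by (simp add: lmeasurable_open)
  then interpret finite_measure ?M by (rule finite_measure_lebesgue_on)
  have V: "measure ?M (space ?M) > 0"
  proof -
    have "\<not> negligible \<Omega>" using \<Omega> open_not_negligible by blast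
    then have "measure lebesgue \<Omega> \<noteq> 0" using lm by (simp add: negligible_iff_measure)
    then show ?thesis using lm by (simp add: measure_restrict_space zero_less_measure_iff)
  qed
  have eq: "sobolev_const p \<Omega> q = Inf {E u / (\<integral>x. \<bar>u x\<bar> powr q \<partial>?M) powr (p / q) | u. u \<in> U}"
    if "q > 0" for q
    unfolding sobolev_const_def U_def E_def by (simp add: Lp_norm_powr[OF that])
  have E: "E u = (\<integral>x. norm (weak_gradient \<Omega> u x) powr p \<partial>?M)" for u
    unfolding E_def using p by (simp add: Lp_norm_powr)
  show ?thesis
  proof (cases "U = {}")
    case True
    have "absolutely_continuous_on_interval 1 P (\<lambda>_. Inf {})"
      unfolding absolutely_continuous_on_interval_def by (auto intro!: exI[of _ 1])
    then show ?thesis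
      unfolding P_def[symmetric]
      by (rule absolutely_continuous_on_interval_cong) (simp add: eq True)
  next
    case False
    have AC: "absolutely_continuous_on_interval 1 P
        (\<lambda>q. Inf {E u / (\<integral>x. \<bar>u x\<bar> powr q \<partial>?M) powr (p / q) | u. u \<in> U})"
    proof (rule absolutely_continuous_Inf_quotient[OF _ P1 V False])
      show "u \<in> borel_measurable ?M" if "u \<in> U" for u
        using that unfolding U_def W1p_0_def W1p_def Lp_space_def by auto
      fix q assume q: "0 < q" "q < P"
      \<comment> \<open>the embedding needs an exponent above \<open>p\<close>; lower exponents follow from finiteness of the measure\<close>
      define r where "r = (max p q + P) / 2"
      have r: "p < r" "q < r" "r < P" unfolding r_def using q \<open>p < P\<close> by auto
      have "N * (1 / p - 1 / r) < 1"
      proof -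
        have "r * (N - p) < N * p" using r(3) p unfolding PN by (simp add: less_divide_eq)
        then have "N * (r - p) < p * r" by (simp add: algebra_simps)
        then show ?thesis using p r by (simp add: field_simps)
      qed
      then have "real DIM(real ^ 'N) * (1 / p - 1 / r) < 1" by (simp add: N_def)
      from W1p_0_subcritical_embedding[OF \<Omega>(1,2) p(1) r(1) this]
      obtain C where C: "C > 0" "\<And>u. u \<in> W1p_0 p \<Omega> \<Longrightarrow> integrable ?M (\<lambda>x. \<bar>u x\<bar> powr r)"
        "\<And>u. u \<in> W1p_0 p \<Omega> \<Longrightarrow> (\<integral>x. \<bar>u x\<bar> powr r \<partial>?M) \<le> C * E u powr (r / p)"
        unfolding E by blast
      define D where "D = measure ?M (space ?M) powr (1 - q / r) * C powr (q / r)"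
      have D: "D > 0" unfolding D_def using V C(1) by simp
      have "1 / D powr (p / q) \<le> E u / (\<integral>x. \<bar>u x\<bar> powr q \<partial>?M) powr (p / q)" if u: "u \<in> U" for u
      proof -
        have uW: "u \<in> W1p_0 p \<Omega>" and nz: "\<not> (AE x in ?M. u x = 0)" using u unfolding U_def by auto
        note m = integral_powr_mono_exponent[OF C(2)[OF uW] q(1) r(2)]
        let ?I = "\<integral>x. \<bar>u x\<bar> powr q \<partial>?M"
        have E0: "E u \<ge> 0" unfolding E_def by simp
        have "?I \<noteq> 0" using integral_nonneg_eq_0_iff_AE[OF m(1)] nz by auto
        moreover have "?I \<ge> 0" by simp
        ultimately have I0: "?I > 0" by linarith
        have "(\<integral>x. \<bar>u x\<bar> powr r \<partial>?M) powr (q / r) \<le> (C * E u powr (r / p)) powr (q / r)"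
          using C(3)[OF uW] q r by (intro powr_mono2) auto
        also have "\<dots> = C powr (q / r) * E u powr (q / p)"
          using C(1) r q by (simp add: powr_mult powr_powr)
        finally have "?I \<le> D * E u powr (q / p)"
          using m(2) unfolding D_def mult.assoc by (meson mult_left_mono order_trans powr_ge_zero)
        then have "?I powr (p / q) \<le> (D * E u powr (q / p)) powr (p / q)"
          using I0 p q by (intro powr_mono2) auto
        also have "\<dots> = D powr (p / q) * E u"
          using D E0 p q by (simp add: powr_mult powr_powr)
        finally show ?thesis using I0 D by (simp add: field_simps)
      qed
      then have "1 / D powr (p / q) \<le> Inf {E u / (\<integral>x. \<bar>u x\<bar> powr q \<partial>?M) powr (p / q) | u. u \<in> U}"
        using False by (intro cInf_greatest) auto
      moreover have "1 / D powr (p / q) > 0" using D by simp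
      ultimately show "Inf {E u / (\<integral>x. \<bar>u x\<bar> powr q \<partial>?M) powr (p / q) | u. u \<in> U} > 0" by linarith
    qed (use p in \<open>auto simp: U_def E_def\<close>)
    then show ?thesis
      unfolding P_def[symmetric] by (rule absolutely_continuous_on_interval_cong) (simp add: eq)
  qed
qed

end
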